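(* Let $q$ be a prime power, $n$ a positive integer coprime to $q$, $\gamma\in\mathbb{Z}/n\mathbb{Z}$, $\tau=|c_{n/q}(\gamma)|$. (1) The assignment $\chi_{c_{n/q}(\gamma)}:\big(c_{n/q}(\gamma)=\bigsqcup_{j=0}^{t-1}c_{n/q^t}(\gamma q^j)\big)\mapsto\mathbb{F}_{q^t}$, where $t$ ranges over divisors of $\tau$ divisible by $\omega_\gamma$, is a one-to-one correspondence from $\mathcal{MER}(c_{n/q}(\gamma))$ onto the set of extension fields of $\mathbb{F}_q$ contained in $\mathbb{F}_{q^\tau}$ over which $M_{c_{n/q}(\gamma)}(X)$ factors into irreducible binomials. Moreover, for two such representations with parameters $t_1,t_2$, one has $\bigsqcup_{j=0}^{t_2-1}c_{n/q^{t_2}}(\gamma q^j)\le\bigsqcup_{j=0}^{t_1-1}c_{n/q^{t_1}}(\gamma q^j)$ if and only if $\mathbb{F}_{q^{t_1}}\subseteq\mathbb{F}_{q^{t_2}}$. (2) The assignment $\chi_{n/q}:\big(c_{n/q}(\gamma)=\bigsqcup_{j=0}^{\gcd(t,\tau_\gamma)-1}c_{n/q^t}(\gamma q^j)\big)_{c_{n/q}(\gamma)\in\mathcal{C}_{n/q}}\mapsto\mathbb{F}_{q^t}$, where $t$ ranges over divisors of $\mathrm{ord}_n(q)$ divisible by $\omega$, is a one-to-one correspondence from $\mathcal{MER}_{n/q}$ onto the set of extension fields of $\mathbb{F}_q$ contained in $\mathbb{F}_{q^{\mathrm{ord}_n(q)}}$ over which $X^n-1$ factors into irreducible binomials. Moreover,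 for two elements of $\mathcal{MER}_{n/q}$ with parameters $t_1,t_2$, the first is coarser than the second if and only if $\mathbb{F}_{q^{t_1}}\subseteq\mathbb{F}_{q^{t_2}}$.
   Context: For $N$ coprime to $n$ and $\gamma\in\mathbb{Z}/n\mathbb{Z}$, $c_{n/N}(\gamma)=\{\gamma,\gamma N,\dots,\gamma N^{\sigma-1}\}$ with $\sigma$ least positive such that $\gamma N^\sigma\equiv\gamma\pmod n$; $\tau_\gamma=|c_{n/q}(\gamma)|$; $\mathcal{C}_{n/q}$ is the set of all $q$-cyclotomic cosets modulo $n$. For $t\ge1$, the $q^t$-cyclotomic decomposition is $c_{n/q}(\gamma)=\bigsqcup_{j=0}^{\gcd(t,\tau_\gamma)-1}c_{n/q^t}(\gamma q^j)$. A subset $E\subseteq c_{n/q}(\gamma)$ with $|E|=\tau_E$ is an equal-difference subset if $\tau_E\mid n$ and $E=\{e,e+\frac n{\tau_E},\dots,e+(\tau_E-1)\frac n{\tau_E}\}$ in $\mathbb{Z}/n\mathbb{Z}$ for some $e\in E$; an equal-difference decomposition is a partition into such subsets. For two decompositions, $\bigsqcup_{j\in J}E'_j\le\bigsqcup_{i\in I}E_i$ ("finer"; the right side is "coarser") if $J=\bigsqcup_{i}J_i$ with $E_i=\bigsqcup_{j\in J_i}E'_j$. $\mathcal{MER}(c_{n/q}(\gamma))$ is the set of equal-difference decompositions of $c_{n/q}(\gamma)$ which are $q^t$-cyclotomic decompositions for some $t$; $\mathcal{MER}_{n/q}$ is the set of tuples of $q^t$-cyclotomic decompositions (same $t$ for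 all cosets in $\mathcal{C}_{n/q}$) each of which lies in the corresponding $\mathcal{MER}$, ordered componentwise. Fix a compatible family of primitive roots of unity $\zeta_m$ ($\gcd(m,q)=1$, $\zeta_n^{n/m}=\zeta_m$ for $m\mid n$) in an algebraic closure of $\mathbb{F}_q$, and $M_{c_{n/q}(\gamma)}(X)=\prod_{j=0}^{\tau-1}(X-\zeta_n^{\gamma q^j})$. Binomial: monic of the form $X^k+a$. With $n_\gamma=n/\gcd(\gamma,n)$, $\mathrm{rad}$ the product of distinct prime divisors and $\mathrm{ord}_m(q)$ the order of $q$ mod $m$: $\omega_\gamma=2\,\mathrm{ord}_{\mathrm{rad}(n_\gamma)}(q)$ if $q^{\mathrm{ord}_{\mathrm{rad}(n_\gamma)}(q)}\equiv3\pmod4$ and $8\mid n_\gamma$, else $\omega_\gamma=\mathrm{ord}_{\mathrm{rad}(n_\gamma)}(q)$; $\omega$ is defined likewise with $n$ in place of $n_\gamma$. *)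

theory Defs
  imports
    "HOL-Algebra.Algebraic_Closure_Type"
    "HOL-Algebra.Sylow"
    "HOL-Number_Theory.Number_Theory"
    "HOL-Library.Disjoint_Sets"
begin

text \<open>
  Residue classes modulo \<open>n\<close> are represented by their least non-negative representatives, so that
  subsets of \<open>\<int>/n\<int>\<close> are subsets of \<open>{..<n}\<close>.
\<close>

definition coset_period :: "nat \<Rightarrow> nat \<Rightarrow> nat \<Rightarrow> nat" where
  "coset_period n N \<gamma> = (LEAST \<sigma>. \<sigma> > 0 \<and> [\<gamma> * N ^ \<sigma> = \<gamma>] (mod n))"

definition cyc_coset :: "nat \<Rightarrow> nat \<Rightarrow> nat \<Rightarrow> nat set" where
  "cyc_coset n N \<gamma> = (\<lambda>j. \<gamma> * N ^ j mod n) ` {..<coset_period n N \<gamma>}"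

definition cyc_cosets :: "nat \<Rightarrow> nat \<Rightarrow> nat set set" where
  "cyc_cosets n q = cyc_coset n q ` {..<n}"

text \<open>
  A decomposition of a coset is represented as a partition, i.e. as the set of its blocks.
\<close>

definition cyc_decomp :: "nat \<Rightarrow> nat \<Rightarrow> nat \<Rightarrow> nat \<Rightarrow> nat set set" where
  "cyc_decomp n q t \<gamma> =
     (\<lambda>j. cyc_coset n (q ^ t) (\<gamma> * q ^ j)) ` {..<gcd t (card (cyc_coset n q \<gamma>))}"

definition equal_difference :: "nat \<Rightarrow> nat set \<Rightarrow> bool" where
  "equal_difference n E \<longleftrightarrow>
     card E dvd n \<and> (\<exists>e\<in>E. E = (\<lambda>k. (e + k * (n div card E)) mod n) ` {..<card E})"

definition equal_difference_decomp :: "nat \<Rightarrow> nat set \<Rightarrow> nat set set \<Rightarrow> bool" where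
  "equal_difference_decomp n C P \<longleftrightarrow> partition_on C P \<and> (\<forall>E\<in>P. equal_difference n E)"

text \<open>
  \<open>finer P' P\<close> is \<open>P' \<le> P\<close>: the index set \<open>P'\<close> is the disjoint union of subfamilies \<open>J E\<close>
  (one for each block \<open>E\<close> of \<open>P\<close>) such that \<open>E\<close> is the union of the blocks in \<open>J E\<close>.
\<close>

definition finer :: "nat set set \<Rightarrow> nat set set \<Rightarrow> bool" where
  "finer P' P \<longleftrightarrow>
     (\<exists>J. disjoint_family_on J P \<and> P' = (\<Union>E\<in>P. J E) \<and> (\<forall>E\<in>P. E = \<Union> (J E) \<and> disjoint (J E)))"

definition MER :: "nat \<Rightarrow> nat \<Rightarrow> nat \<Rightarrow> nat set set set" where
  "MER n q \<gamma> =
     {P. equal_difference_decomp n (cyc_coset n q \<gamma>) P \<and> (\<exists>t\<ge>1. P = cyc_decomp n q t \<gamma>)}"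

text \<open>
  Tuples indexed by the set of cosets are functions on cosets, normalised to be \<open>undefined\<close>
  elsewhere. \<open>is_cyc_decomp_tuple n q t D\<close> says that \<open>D\<close> is the tuple of \<open>q\<^sup>t\<close>-cyclotomic
  decompositions; it quantifies over all representatives of each coset.
\<close>

definition is_cyc_decomp_tuple ::
  "nat \<Rightarrow> nat \<Rightarrow> nat \<Rightarrow> (nat set \<Rightarrow> nat set set) \<Rightarrow> bool" where
  "is_cyc_decomp_tuple n q t D \<longleftrightarrow>
     D \<in> extensional (cyc_cosets n q) \<and> (\<forall>\<gamma><n. D (cyc_coset n q \<gamma>) = cyc_decomp n q t \<gamma>)"

definition MER_all :: "nat \<Rightarrow> nat \<Rightarrow> (nat set \<Rightarrow> nat set set) set" where
  "MER_all n q =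
     {D. (\<exists>t\<ge>1. is_cyc_decomp_tuple n q t D) \<and> (\<forall>\<gamma><n. D (cyc_coset n q \<gamma>) \<in> MER n q \<gamma>)}"

definition tuple_finer ::
  "nat \<Rightarrow> nat \<Rightarrow> (nat set \<Rightarrow> nat set set) \<Rightarrow> (nat set \<Rightarrow> nat set set) \<Rightarrow> bool" where
  "tuple_finer n q D' D \<longleftrightarrow> (\<forall>C\<in>cyc_cosets n q. finer (D' C) (D C))"

definition rad :: "nat \<Rightarrow> nat" where
  "rad m = \<Prod>(prime_factors m)"

text \<open>
  \<open>\<omega>\<^sub>\<gamma>\<close> is \<open>omega q (n div gcd \<gamma> n)\<close>, and \<open>\<omega>\<close> is \<open>omega q n\<close>.
\<close>

definition omega :: "nat \<Rightarrow> nat \<Rightarrow> nat" where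
  "omega q m =
     (if [q ^ ord (rad m) q = 3] (mod 4) \<and> 8 dvd m then 2 * ord (rad m) q else ord (rad m) q)"

definition is_subfield :: "'a :: field set \<Rightarrow> bool" where
  "is_subfield K \<longleftrightarrow> subfield K (ring_of_type_algebra :: 'a ring)"

lemma is_subfield_iff:
  fixes K :: "'a :: field set"
  shows "is_subfield K \<longleftrightarrow>
    1 \<in> K \<and> (\<forall>x\<in>K. \<forall>y\<in>K. x + y \<in> K \<and> x * y \<in> K) \<and> (\<forall>x\<in>K. - x \<in> K \<and> inverse x \<in> K)"
proof -
  define R where "R = (ring_of_type_algebra :: 'a ring)"
  interpret R: field R
    unfolding R_def by (rule field_from_type_algebra)
  have sel: "carrier R = UNIV" "monoid.mult R = (*)" "one R = 1" "ring.zero R = 0" "ring.add R = (+)"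
    by (simp_all add: R_def ring_of_type_algebra_def)
  have neg: "a_inv R x = - x" for x
    by (rule R.minus_equality) (simp_all add: sel)
  have inv: "m_inv R x = inverse x" if "x \<noteq> 0" for x
    by (rule sym, rule R.inv_unique') (use that in \<open>simp_all add: sel\<close>)
  show ?thesis
  proof
    assume "is_subfield K"
    then have K: "subfield K R"
      by (simp add: is_subfield_def R_def)
    note sr = subringE[OF subfieldE(1)[OF K]]
    have "inverse x \<in> K" if "x \<in> K" for x
      using R.subfield_m_inv(1)[OF K, of x] that inv[of x] by (cases "x = 0") (auto simp: sel)
    then show "1 \<in> K \<and> (\<forall>x\<in>K. \<forall>y\<in>K. x + y \<in> K \<and> x * y \<in> K) \<and> (\<forall>x\<in>K. - x \<in> K \<and> inverse x \<in> K)"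
      using sr(3,5,6,7) by (auto simp: sel neg)
  next
    assume *: "1 \<in> K \<and> (\<forall>x\<in>K. \<forall>y\<in>K. x + y \<in> K \<and> x * y \<in> K) \<and> (\<forall>x\<in>K. - x \<in> K \<and> inverse x \<in> K)"
    have "subring K R"
      by (rule R.subringI) (use * in \<open>auto simp: sel neg\<close>)
    then have "subfield K R"
      by (rule R.subfieldI') (use * in \<open>auto simp: sel inv\<close>)
    then show "is_subfield K"
      by (simp add: is_subfield_def R_def)
  qed
qed

text \<open>
  With \<open>\<F>\<^sub>q\<close> a finite field type \<open>'f\<close> of cardinality \<open>q\<close>, the field \<open>\<F>\<^bsub>q^t\<^esub>\<close> is \<open>GF (q ^ t)\<close>, the
  unique subfield of \<open>'f alg_closure\<close> of that order (see \<open>ex1_GF\<close> below).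
\<close>

definition GF :: "nat \<Rightarrow> 'f :: finite_field alg_closure set" where
  "GF Q = (THE K. is_subfield K \<and> card K = Q)"

lemma subfield_power_card:
  fixes K :: "'a :: field set"
  assumes K: "is_subfield K" and fin: "finite K" and x: "x \<in> K"
  shows "x ^ card K = x"
proof (cases "x = 0")
  case True
  then show ?thesis
    using x fin by (auto simp: card_gt_0_iff power_0_left)
next
  case False
  have zero: "0 \<in> K"
    using K x unfolding is_subfield_iff by (metis add.right_inverse)
  have bij: "(\<Prod>y\<in>K-{0}. x * y) = (\<Prod>y\<in>K-{0}. y)"
    by (rule prod.reindex_bij_witness[of _ "\<lambda>y. inverse x * y" "\<lambda>y. x * y"])
       (use False K x in \<open>auto simp: is_subfield_iff\<close>)
  have nz: "(\<Prod>y\<in>K-{0}. y) \<noteq> 0"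
    using fin by simp
  have "x ^ (card K - 1) * (\<Prod>y\<in>K-{0}. y) = (\<Prod>y\<in>K-{0}. x * y)"
    using fin zero by (simp add: prod.distrib)
  then have "x ^ (card K - 1) = 1"
    using bij nz by simp
  moreover have "card K > 0"
    using fin x by (auto simp: card_gt_0_iff)
  ultimately show ?thesis
    by (cases "card K") auto
qed

lemma card_finite_field_primepow:
  "\<exists>k>0. card (UNIV :: 'f :: finite_field set) = CHAR('f) ^ k"
proof -
  let ?G = "add_monoid (ring_of_type_algebra :: 'f ring)"
  let ?p = "CHAR('f)" and ?q = "card (UNIV :: 'f set)"
  interpret R: ring "ring_of_type_algebra :: 'f ring"
    by (rule ring_from_type_algebra)
  have sel: "carrier ?G = UNIV" "monoid.mult ?G = (+)" "one ?G = 0"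
    by (simp_all add: ring_of_type_algebra_def)
  have pow: "x [^]\<^bsub>?G\<^esub> k = of_nat k * x" for x :: 'f and k :: nat
    by (induction k) (simp_all add: ring_of_type_algebra_def algebra_simps)
  have q: "?q > 1"
  proof -
    have "card {0, 1 :: 'f} \<le> ?q"
      by (rule card_mono) auto
    then show ?thesis by simp
  qed
  have only: "r = ?p" if r: "prime r" "r dvd ?q" for r
  proof -
    define a where "a = multiplicity r ?q"
    have "a > 0"
      unfolding a_def using r q by (simp add: prime_multiplicity_gt_zero_iff)
    have ord: "Coset.order ?G = r ^ a * (?q div r ^ a)"
      by (simp add: Coset.order_def ring_of_type_algebra_def a_def multiplicity_dvd)
    obtain H where H: "subgroup H ?G" "card H = r ^ a"
      using sylow_thm[OF r(1) R.add.is_group ord] by (auto simp: sel)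
    have "finite H"
      by (rule finite_subset[OF subset_UNIV]) simp
    have "card H > 1"
      unfolding H(2) by (rule one_less_power[OF prime_gt_1_nat[OF r(1)] \<open>a > 0\<close>])
    then have "\<not> H \<subseteq> {0}"
      using card_mono[of "{0}" H] by auto
    then obtain x where x: "x \<in> H" "x \<noteq> 0"
      by auto
    interpret H: group "?G\<lparr>carrier := H\<rparr>"
      by (rule subgroup.subgroup_is_group[OF H(1) R.add.is_group])
    have "x [^]\<^bsub>?G\<lparr>carrier := H\<rparr>\<^esub> Coset.order (?G\<lparr>carrier := H\<rparr>) = one (?G\<lparr>carrier := H\<rparr>)"
      by (rule H.pow_order_eq_1) (use x in simp)
    then have "of_nat (r ^ a) * x = 0"
      using pow[of x "r ^ a"] H(2) by (simp add: Coset.order_def nat_pow_def ring_of_type_algebra_def)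
    then have "?p dvd r ^ a"
      using x(2) of_nat_eq_0_iff_char_dvd[of "r ^ a", where ?'a = 'f] by simp
    then show ?thesis
      using r(1) prime_dvd_power[of ?p r a] primes_dvd_imp_eq[of ?p r] by simp
  qed
  have "?q \<noteq> 0" "\<not> is_unit ?p"
    using q by auto
  then obtain m where m: "?q = ?p ^ multiplicity ?p ?q * m" "\<not> ?p dvd m"
    by (rule multiplicity_decompose')
  have "m = 1"
  proof (rule ccontr)
    assume "m \<noteq> 1"
    then obtain r where "prime r" "r dvd m"
      using prime_factor_nat by blast
    then show False
      using only[of r] m by (metis dvd_mult)
  qed
  then have *: "?q = ?p ^ multiplicity ?p ?q"
    using m(1) by simp
  have "multiplicity ?p ?q \<noteq> 0"
  proof
    assume "multiplicity ?p ?q = 0"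
    with * have "?q = 1"
      by (metis power_0)
    with q show False by simp
  qed
  with * show ?thesis
    by (intro exI[of _ "multiplicity ?p ?q"]) simp
qed

lemma card_roots_power_diff:
  fixes Q :: nat
  assumes "Q > 1" "of_nat Q = (0 :: 'a :: alg_closed_field)"
  shows "card {x :: 'a. x ^ Q = x} = Q" "finite {x :: 'a. x ^ Q = x}"
proof -
  define P :: "'a poly" where "P = Polynomial.monom 1 Q - Polynomial.monom 1 1"
  have deg: "Polynomial.degree P = Q"
    unfolding P_def using assms(1)
    by (subst diff_conv_add_uminus, subst Polynomial.degree_add_eq_left) (auto simp: Polynomial.degree_monom_eq)
  then have [simp]: "P \<noteq> 0" using assms(1) by auto
  have pd: "Polynomial.pderiv P = - 1"
    using assms by (simp add: P_def Polynomial.pderiv_diff Polynomial.pderiv_monom one_pCons[symmetric])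
  have sf: "order x P \<le> 1" for x
  proof (rule ccontr)
    assume "\<not> order x P \<le> 1"
    then have "[:-x, 1:] ^ 2 dvd P"
      by (intro dvd_trans[OF le_imp_power_dvd order_1]) simp
    then obtain R where "P = [:-x, 1:] ^ 2 * R"
      by (elim dvdE)
    then have "P = [:-x, 1:] * ([:-x, 1:] * R)"
      by (simp only: power2_eq_square mult.assoc)
    then have "poly (Polynomial.pderiv P) x = 0"
      by (simp only: Polynomial.pderiv_mult poly_add poly_mult) simp
    then show False
      by (simp add: pd)
  qed
  have roots: "{x. poly P x = 0} = {x. x ^ Q = x}"
    by (auto simp: P_def poly_monom)
  obtain A where A: "size A = Q" "P = Polynomial.smult (Polynomial.lead_coeff P) (\<Prod>x\<in>#A. [:-x, 1:])"
    using alg_closed_imp_factorization[of P] deg by auto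
  have "proots P = proots (\<Prod>p\<in>#image_mset (\<lambda>x. [:-x, 1:]) A. p)"
    using A(2) by (metis \<open>P \<noteq> 0\<close> image_mset_cong leading_coeff_0_iff multiset.map_ident proots_smult)
  also have "\<dots> = A"
    by (subst proots_prod_mset) (auto simp: image_mset.compositionality o_def)
  finally have pA: "proots P = A" .
  have "count A x \<le> 1" for x
    using sf[of x] by (simp add: pA[symmetric])
  then have "size A = card (set_mset A)"
    unfolding size_multiset_overloaded_eq card_eq_sum
    by (intro sum.cong) (auto simp: le_antisym Suc_le_eq)
  then show "card {x :: 'a. x ^ Q = x} = Q" 
    using A(1) roots set_count_proots[of P] pA by simp
  then show "finite {x :: 'a. x ^ Q = x}"
    using assms(1) by (intro card_ge_0_finite) simp
qed

lemma GF_props: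
  fixes t :: nat
  assumes "t > 0" and Q: "Q = card (UNIV :: 'f :: finite_field set) ^ t"
  shows ex1_GF: "\<exists>!K :: 'f alg_closure set. is_subfield K \<and> card K = Q"
    and GF_eq: "(GF Q :: 'f alg_closure set) = {x. x ^ Q = x}"
proof -
  let ?S = "{x :: 'f alg_closure. x ^ Q = x}"
  obtain k where k: "k > 0" "card (UNIV :: 'f set) = CHAR('f) ^ k"
    using card_finite_field_primepow by blast
  then have Qp: "Q = CHAR('f alg_closure) ^ (k * t)"
    using Q by (simp add: power_mult)
  have p: "prime CHAR('f alg_closure)" by simp
  have "Q > 1"
    unfolding Qp by (rule one_less_power) (use k assms p prime_gt_1_nat in auto)
  have "of_nat Q = (0 :: 'f alg_closure)"
    unfolding of_nat_eq_0_iff_char_dvd unfolding Qp using k assms by simp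
  note S = card_roots_power_diff[OF \<open>Q > 1\<close> this]
  have add: "(x + y) ^ Q = x ^ Q + y ^ Q" for x y :: "'f alg_closure"
    by (rule freshmans_dream'[OF p Qp])
  have "(- x) ^ Q = - x" if "x ^ Q = x" for x :: "'f alg_closure"
    using add[of x "- x"] that \<open>Q > 1\<close> by (simp add: power_0_left add_eq_0_iff)
  then have sub: "is_subfield ?S"
    by (auto simp: is_subfield_iff add power_mult_distrib power_inverse)
  have uniq: "K = ?S" if K: "is_subfield K" "card K = Q" for K
  proof (rule card_subset_eq[OF S(2)])
    have "finite K"
      using K(2) \<open>Q > 1\<close> by (intro card_ge_0_finite) simp
    then show "K \<subseteq> ?S"
      using subfield_power_card[OF K(1)] K(2) by auto
  qed (use K S in simp)
  show "\<exists>!K :: 'f alg_closure set. is_subfield K \<and> card K = Q"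
    using sub S(1) uniq by blast
  show "(GF Q :: 'f alg_closure set) = ?S"
    unfolding GF_def by (rule the_equality) (use sub S(1) in simp, use uniq in blast)
qed

definition extensions_within :: "'f :: finite_field alg_closure set \<Rightarrow> 'f alg_closure set set" where
  "extensions_within L = {K. is_subfield K \<and> range to_ac \<subseteq> K \<and> K \<subseteq> L}"

definition polys_over :: "'a :: field set \<Rightarrow> 'a poly set" where
  "polys_over K = {p. \<forall>i. Polynomial.coeff p i \<in> K}"

definition irreducible_over :: "'a :: field set \<Rightarrow> 'a poly \<Rightarrow> bool" where
  "irreducible_over K p \<longleftrightarrow>
     p \<in> polys_over K \<and> Polynomial.degree p > 0 \<and>
     (\<forall>g\<in>polys_over K. \<forall>h\<in>polys_over K.
        p = g * h \<longrightarrow> Polynomial.degree g = 0 \<or> Polynomial.degree h = 0)"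

definition is_binomial :: "'a :: field poly \<Rightarrow> bool" where
  "is_binomial p \<longleftrightarrow> (\<exists>k a. k > 0 \<and> p = Polynomial.monom 1 k + [:a:])"

definition factors_into_irreducible_binomials :: "'a :: field set \<Rightarrow> 'a poly \<Rightarrow> bool" where
  "factors_into_irreducible_binomials K p \<longleftrightarrow>
     (\<exists>F. p = prod_mset F \<and> (\<forall>f\<in>#F. irreducible_over K f \<and> is_binomial f))"

definition primitive_root_of_unity :: "nat \<Rightarrow> 'a :: field \<Rightarrow> bool" where
  "primitive_root_of_unity m z \<longleftrightarrow> z ^ m = 1 \<and> (\<forall>k. 0 < k \<and> k < m \<longrightarrow> z ^ k \<noteq> 1)"

definition compatible_roots_of_unity :: "nat \<Rightarrow> (nat \<Rightarrow> 'a :: field) \<Rightarrow> bool" where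
  "compatible_roots_of_unity q \<zeta> \<longleftrightarrow>
     (\<forall>m>0. coprime m q \<longrightarrow> primitive_root_of_unity m (\<zeta> m)) \<and>
     (\<forall>n>0. \<forall>m. coprime n q \<and> m dvd n \<longrightarrow> \<zeta> n ^ (n div m) = \<zeta> m)"

definition coset_poly :: "(nat \<Rightarrow> 'a :: field) \<Rightarrow> nat \<Rightarrow> nat \<Rightarrow> nat \<Rightarrow> 'a poly" where
  "coset_poly \<zeta> n q \<gamma> = (\<Prod>j<card (cyc_coset n q \<gamma>). [:- (\<zeta> n ^ (\<gamma> * q ^ j)), 1:])"

end

theory Submission
  imports Defs
begin

text \<open>
  Write \<open>m = n / gcd(\<gamma>, n)\<close> and \<open>Q = q\<^sup>t\<close>. Up to multiplication by a unit, the coset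
  \<open>c\<^bsub>n/Q\<^esub>(\<gamma>)\<close> is the subgroup of \<open>(\<int>/m\<int>)\<^sup>\<times>\<close> generated by \<open>Q\<close>. It is an arithmetic progression iff it
  equals \<open>1 + d\<int>/m\<int>\<close> for some \<open>d\<close>; then every prime divisor of \<open>m\<close> divides \<open>d\<close> and hence \<open>Q - 1\<close>.
  Conversely, if \<open>Q \<equiv> 1\<close> modulo \<open>rad m\<close>, then lifting the exponent shows that the order of \<open>Q\<close> modulo \<open>m\<close>
  is \<open>m / gcd(Q - 1, m)\<close>, except when \<open>8 | m\<close> and \<open>Q \<equiv> 3\<close> modulo \<open>4\<close>. In terms of \<open>t\<close> the criterion
  reads \<open>\<omega>\<^sub>\<gamma> | t\<close>.

  On the field side, the monic irreducible polynomial over \<open>\<F>\<^sub>Q\<close> with root \<open>\<zeta>\<^sub>n\<^sup>\<gamma>\<close> is the product over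
  \<open>c\<^bsub>n/Q\<^esub>(\<gamma>)\<close>, and it is a binomial \<open>X\<^sup>k + a\<close> iff its roots form a coset of the \<open>k\<close>-th roots
  of unity, i.e. iff \<open>c\<^bsub>n/Q\<^esub>(\<gamma>)\<close> is an equal-difference set. So both sides of the correspondence are indexed by the
  \<open>t\<close> with \<open>\<omega>\<^sub>\<gamma> | t | \<tau>\<close>, and both orders become divisibility of these \<open>t\<close>.
\<close>

section \<open>Orders of integers congruent to 1 modulo the radical\<close>

lemma coprimeI_prime:
  fixes a b :: "'a :: factorial_semiring_gcd"
  assumes "a \<noteq> 0" and "\<And>p. prime p \<Longrightarrow> p dvd a \<Longrightarrow> p dvd b \<Longrightarrow> False"
  shows "coprime a b"
proof (rule ccontr)
  assume "\<not> coprime a b"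
  then obtain p where "prime p" "p dvd gcd a b"
    using assms(1) prime_divisor_exists[of "gcd a b"] by (auto simp: is_unit_gcd_iff)
  then show False using assms(2) by auto
qed

text \<open>Modulo \<open>p ^ 2\<close> the sum is \<open>p\<close> plus \<open>R - 1\<close> times
  the triangular number \<open>p * (p - 1) / 2\<close>. The latter term vanishes: for odd
  \<open>p\<close> because \<open>p\<close> divides the triangular number, for \<open>p = 2\<close>
  because of \<open>four\<close>.\<close>

lemma prime_square_not_dvd_geometric_sum:
  fixes p R :: int
  assumes p: "prime p" and R: "p dvd R - 1" and four: "p = 2 \<Longrightarrow> 4 dvd R - 1"
  shows "\<not> p ^ 2 dvd (\<Sum>i<nat p. R ^ i)"
proof -
  have p0: "p > 1" using p prime_gt_1_int by blast
  \<comment> \<open>First-order expansion of \<open>R ^ i\<close> around 1; each induction step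
    discards a multiple of \<open>(R - 1) ^ 2\<close>.\<close>
  have *: "[R ^ i = 1 + of_nat i * (R - 1)] (mod p ^ 2)" for i
  proof (induction i)
    case (Suc i)
    have "[R ^ Suc i = R * (1 + of_nat i * (R - 1))] (mod p ^ 2)"
      using cong_mult[OF cong_refl[of R] Suc] by simp
    also have "R * (1 + of_nat i * (R - 1)) = (1 + of_nat (Suc i) * (R - 1)) + of_nat i * (R - 1) ^ 2"
      by (simp add: algebra_simps power2_eq_square)
    also have "[\<dots> = 1 + of_nat (Suc i) * (R - 1)] (mod p ^ 2)"
    proof -
      have "p ^ 2 dvd of_nat i * (R - 1) ^ 2"
        using R by (intro dvd_mult dvd_power_same)
      then show ?thesis by (simp add: cong_iff_dvd_diff)
    qed
    finally show ?case .
  qed simp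
  have gs: "(\<Sum>i<k. int i) * 2 = int k * (int k - 1)" for k :: nat
    by (induction k) (auto simp: algebra_simps)
  have "[(\<Sum>i<nat p. R ^ i) = (\<Sum>i<nat p. 1 + int i * (R - 1))] (mod p ^ 2)"
    by (intro cong_sum *)
  also have "(\<Sum>i<nat p. 1 + int i * (R - 1)) = p + (\<Sum>i<nat p. int i) * (R - 1)"
    using p0 by (simp add: sum.distrib sum_distrib_right)
  also have "[\<dots> = p] (mod p ^ 2)"
  proof -
    have "p ^ 2 dvd (\<Sum>i<nat p. int i) * (R - 1)"
    proof (cases "p = 2")
      case True
      then show ?thesis using four by (simp add: numeral_2_eq_2)
    next
      case False
      then have "coprime p 2" using p two_is_prime_nat
        by (metis primes_coprime two_is_prime)
      moreover have "p dvd (\<Sum>i<nat p. int i) * 2"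
        using gs[of "nat p"] p0 by simp
      ultimately have "p dvd (\<Sum>i<nat p. int i)"
        using coprime_dvd_mult_left_iff by blast
      then show ?thesis using R by (simp add: power2_eq_square mult_dvd_mono)
    qed
    then show ?thesis by (simp add: cong_iff_dvd_diff)
  qed
  finally have "p ^ 2 dvd (\<Sum>i<nat p. R ^ i) \<longleftrightarrow> p ^ 2 dvd p"
    by (rule cong_dvd_iff)
  moreover have "\<not> p ^ 2 dvd p"
    using p0 by (auto dest!: zdvd_imp_le simp: power2_eq_square)
  ultimately show ?thesis by simp
qed

text \<open>
  The lifting-the-exponent step, without valuations: for a prime \<open>p\<close> dividing both \<open>k = l p\<close> and \<open>m\<close>,
  the factor \<open>1 + R + \<dots> + R\<^bsup>p-1\<^esup>\<close> of \<open>Q\<^sup>k - 1\<close> with \<open>R = Q\<^sup>l\<close> is \<open>p\<close> times a number coprime to \<open>m / p\<close>, so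
  \<open>m / p\<close> divides \<open>Q\<^sup>l - 1\<close> and induction on \<open>k\<close> applies.
\<close>

lemma dvd_mult_pred_if_dvd_power_pred:
  fixes m Q :: int
  assumes "m > 0" and "\<And>p. prime p \<Longrightarrow> p dvd m \<Longrightarrow> p dvd Q - 1" and "4 dvd m \<Longrightarrow> 4 dvd Q - 1"
    and "m dvd Q ^ k - 1"
  shows "m dvd int k * (Q - 1)"
  using assms
proof (induction k arbitrary: m rule: less_induct)
  case (less k m)
  have geo: "Q ^ j - 1 = (Q - 1) * (\<Sum>i<j. Q ^ i)" for j
    by (rule power_diff_1_eq)
  have cong1: "[(\<Sum>i<j. R ^ i) = int j] (mod p)" if "p dvd R - 1" for R p :: int and j
  proof -
    have "[R = 1] (mod p)" using that by (simp add: cong_iff_dvd_diff)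
    then have "[(\<Sum>i<j. R ^ i) = (\<Sum>i<j. 1)] (mod p)"
      using cong_pow[of R 1 p] by (intro cong_sum) auto
    then show ?thesis by simp
  qed
  show ?case
  proof (cases "k = 0 \<or> coprime m (int k)")
    case True
    then show ?thesis
    proof
      \<comment> \<open>A prime dividing both \<open>m\<close> and the geometric sum would divide
        \<open>k\<close>, the value of the sum modulo that prime. So the sum cancels and already
        \<open>m\<close> divides \<open>Q - 1\<close>.\<close>
      assume "coprime m (int k)"
      have "coprime m (\<Sum>i<k. Q ^ i)"
      proof (rule coprimeI_prime)
        show "m \<noteq> 0" using less.prems(1) by simp
      next
        fix p assume p: "prime p" "p dvd m" "p dvd (\<Sum>i<k. Q ^ i)"
        then have "p dvd int k"
          using cong_dvd_iff[OF cong1[of p Q k]] less.prems(2)[of p] by simp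
        then show False using p \<open>coprime m (int k)\<close>
          by (meson coprime_common_divisor not_prime_unit)
      qed
      moreover have "m dvd (Q - 1) * (\<Sum>i<k. Q ^ i)"
        using less.prems(4) by (simp only: geo)
      ultimately have "m dvd Q - 1" by (simp add: coprime_dvd_mult_left_iff)
      then show ?thesis by (rule dvd_mult)
    qed simp
  next
    case False
    then obtain p where p: "prime p" "p dvd m" "p dvd int k"
      using coprimeI_prime[of m "int k"] less.prems(1) by fastforce
    have p1: "p > 1" using p(1) prime_gt_1_int by blast
    define l where "l = k div nat p"
    have npk: "nat p dvd k" using p(3) p1 by (simp add: nat_dvd_iff)
    then have k: "k = l * nat p" by (simp add: l_def)
    have "l < k" using k False p1 by (cases "l = 0") auto
    define m' where "m' = m div p"
    have m: "m = p * m'" using p(2) by (simp add: m'_def)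
    have m'0: "m' > 0" using m less.prems(1) p1 by (simp add: zero_less_mult_iff)
    define R where "R = Q ^ l"
    have dR: "r dvd R - 1" if "r dvd Q - 1" for r
      using that geo[of l] by (simp add: R_def)
    define S where "S = (\<Sum>i<nat p. R ^ i)"
    have QS: "Q ^ k - 1 = (R - 1) * S"
      by (simp add: k power_mult R_def S_def power_diff_1_eq)
    have rS: "r dvd S \<longleftrightarrow> r dvd p" if "r dvd Q - 1" for r
      using cong1[OF dR[OF that], of "nat p"] p1 unfolding S_def by (simp add: cong_dvd_iff)
    have "p dvd S" using rS[OF less.prems(2)[OF p(1,2)]] by simp
    then obtain u where u: "S = p * u" by blast
    \<comment> \<open>The only candidate for a common prime is \<open>p\<close> itself, and then
      \<open>p ^ 2\<close> would divide \<open>S\<close>. For \<open>p = 2\<close> this would also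
      make 4 divide \<open>m\<close>, so the hypothesis on 4 is available.\<close>
    have cop: "coprime m' u"
    proof (rule coprimeI_prime)
      show "m' \<noteq> 0" using m'0 by simp
    next
      fix r assume r: "prime r" "r dvd m'" "r dvd u"
      then have rQ: "r dvd Q - 1" using less.prems(2) m by simp
      have "r dvd S" using r(3) u by simp
      then have "r dvd p" using rS[OF rQ] by simp
      then have [simp]: "r = p" using r(1) p(1) by (simp add: primes_dvd_imp_eq)
      have "p ^ 2 dvd S" using r u by (simp add: power2_eq_square)
      moreover have "4 dvd R - 1" if "p = 2"
      proof -
        have "4 dvd m" using r(2) m that by auto
        then show ?thesis using less.prems(3) dR by blast
      qed
      ultimately show False
        using prime_square_not_dvd_geometric_sum[OF p(1), of R] dR rQ unfolding S_def by auto
    qed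
    have "p * m' dvd p * ((R - 1) * u)"
      using less.prems(4) unfolding QS u m by (simp add: ac_simps)
    then have "m' dvd (R - 1) * u" using p1 by simp
    then have "m' dvd Q ^ l - 1" using cop by (simp add: coprime_dvd_mult_left_iff R_def)
    then have "m' dvd int l * (Q - 1)"
      using less.prems(2,3) m by (intro less.IH[OF \<open>l < k\<close> m'0]) auto
    then have "p * m' dvd p * (int l * (Q - 1))" by simp
    then show ?thesis using k p1 m by (simp add: ac_simps)
  qed
qed

text \<open>The case not yet covered is \<open>4 dvd m\<close> with \<open>Q\<close> congruent to 3
  modulo 4; excluding 8 leaves \<open>m = 4 * m'\<close> with \<open>m'\<close> odd. The odd part
  falls under the previous lemma, and 4 divides \<open>k * (Q - 1)\<close> because both factors are
  even.\<close>

lemma dvd_mult_pred_if_dvd_power_pred':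
  fixes m Q :: int
  assumes "m > 0" and p: "\<And>p. prime p \<Longrightarrow> p dvd m \<Longrightarrow> p dvd Q - 1"
    and 8: "\<not> (8 dvd m \<and> [Q = 3] (mod 4))" and dvd: "m dvd Q ^ k - 1"
  shows "m dvd int k * (Q - 1)"
proof (cases "4 dvd m \<and> \<not> 4 dvd Q - 1")
  case False
  then show ?thesis using dvd_mult_pred_if_dvd_power_pred assms by blast
next
  case True
  then obtain m' where m: "m = 4 * m'" by blast
  have "2 dvd Q - 1" using p[of 2] True by (simp add: m)
  then have 3: "[Q = 3] (mod 4)" using True
    by (simp add: cong_iff_dvd_diff) presburger
  then have "odd m'" using 8 m by auto
  then have cop: "coprime 4 m'"
    by (metis coprime_left_2_iff_odd coprime_mult_left_iff mult_2 numeral_Bit0)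
  have "\<not> 4 dvd m'" using \<open>odd m'\<close> by presburger
  then have "m' dvd int k * (Q - 1)"
    using dvd_mult_pred_if_dvd_power_pred[of m' Q k] assms m
    by (metis dvd_mult dvd_mult_right zero_less_mult_pos zero_less_numeral)
  moreover have "4 dvd int k * (Q - 1)"
  proof -
    \<comment> \<open>For odd \<open>k\<close>, \<open>Q ^ k\<close> is -1 modulo 4, so 4 could not
      divide \<open>Q ^ k - 1\<close>.\<close>
    have "even k"
    proof (rule ccontr)
      assume "odd k"
      then obtain j where k: "k = Suc (2 * j)" by (auto elim: oddE)
      have "[Q = - 1] (mod 4)" using 3 by (auto simp: cong_def)
      then have "[Q ^ k = (- 1) ^ k] (mod 4)" by (rule cong_pow)
      then have "[Q ^ k - 1 = - 1 - 1] (mod 4)" using k by (intro cong_diff) auto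
      moreover have "4 dvd Q ^ k - 1" using dvd m by auto
      ultimately show False using cong_dvd_iff by fastforce
    qed
    then show ?thesis using \<open>2 dvd Q - 1\<close> mult_dvd_mono[of 2 "int k" 2 "Q - 1"] by simp
  qed
  ultimately show ?thesis using divides_mult[OF _ _ cop] m by simp
qed

section \<open>The radical and the invariant \<open>omega\<close>\<close>

lemma rad_dvd_iff:
  assumes "m > 0"
  shows "rad m dvd x \<longleftrightarrow> (\<forall>p. prime p \<longrightarrow> p dvd m \<longrightarrow> p dvd x)"
proof
  assume "rad m dvd x"
  moreover have "p dvd rad m" if "prime p" "p dvd m" for p
    unfolding rad_def using that assms by (intro dvd_prodI) (auto simp: prime_factors_dvd)
  ultimately show "\<forall>p. prime p \<longrightarrow> p dvd m \<longrightarrow> p dvd x" by (meson dvd_trans)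
next
  assume *: "\<forall>p. prime p \<longrightarrow> p dvd m \<longrightarrow> p dvd x"
  have "\<Prod>A dvd x" if "finite A" "A \<subseteq> prime_factors m" for A
    using that
  proof (induction A rule: finite_induct)
    case (insert p A)
    have "coprime p (\<Prod>A)"
      using insert by (intro prod_coprime_right) (auto intro!: primes_coprime simp: prime_factors_dvd)
    then show ?case using insert * by (auto intro!: divides_mult simp: prime_factors_dvd)
  qed simp
  then show "rad m dvd x" unfolding rad_def by simp
qed

text \<open>This turns divisibility by \<open>omega\<close> into the hypotheses of lifting the
  exponent for \<open>Q = q ^ t\<close>. The factor 2 in \<open>omega\<close> arises as follows: if
  \<open>q ^ w\<close> is 3 modulo 4 and \<open>t = w * s\<close>, then \<open>q ^ t\<close> is
  \<open>3 ^ s\<close> modulo 4, which is 3 exactly for odd \<open>s\<close>.\<close>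

lemma omega_dvd_iff:
  assumes m: "m > 0" "coprime m q"
  shows "omega q m dvd t \<longleftrightarrow> [q ^ t = 1] (mod rad m) \<and> \<not> (8 dvd m \<and> [q ^ t = 3] (mod 4))"
proof -
  define w where "w = ord (rad m) q"
  have w: "[q ^ t = Suc 0] (mod rad m) \<longleftrightarrow> w dvd t" for t
    unfolding w_def by (rule ord_divides')
  have "(3::nat) ^ s mod 4 = (if even s then 1 else 3)" for s
  proof (induction s)
    case (Suc s)
    have "(3::nat) ^ Suc s mod 4 = 3 * (3 ^ s mod 4) mod 4" by (simp add: mod_mult_right_eq)
    then show ?case unfolding Suc by simp
  qed simp
  then have three: "[(3::nat) ^ s = 3] (mod 4) \<longleftrightarrow> odd s" for s
    by (simp add: cong_def)
  show ?thesis
  proof (cases "w dvd t")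
    case True
    then obtain s where t: "t = w * s" by blast
    show ?thesis
    proof (cases "8 dvd m")
      case 8: True
      have "even m" using 8 by auto
      then have "odd q" using m(2) by auto
      then have "odd (q ^ w)" by simp
      then have "q ^ w mod 4 = 1 \<or> q ^ w mod 4 = 3" by presburger
      then consider "[q ^ w = 1] (mod 4)" | "[q ^ w = 3] (mod 4)"
        by (auto simp: cong_def)
      then show ?thesis
      proof cases
        case 1
        have "[q ^ t = 1] (mod 4)" using cong_pow[OF 1, of s] by (simp add: t power_mult)
        then have "\<not> [q ^ t = 3] (mod 4)" "\<not> [q ^ w = 3] (mod 4)" using 1 by (auto simp: cong_def)
        then show ?thesis using True by (simp add: omega_def w w_def[symmetric])
      next
        case 2
        have c: "[q ^ t = 3 ^ s] (mod 4)" using cong_pow[OF 2, of s] by (simp add: t power_mult)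
        have "[q ^ t = 3] (mod 4) \<longleftrightarrow> odd s"
          using c three[of s] by (metis cong_sym cong_trans)
        \<comment> \<open>Positivity allows cancelling \<open>w\<close> in
          \<open>2 * w dvd w * s\<close>.\<close>
        moreover have "w > 0"
        proof -
          have "coprime (rad m) q"
            unfolding rad_def
          proof (rule prod_coprime_left)
            fix p assume "p \<in> prime_factors m"
            then have "p dvd m" by auto
            then show "coprime p q" using coprime_divisors[OF _ dvd_refl m(2)] by blast
          qed
          then show ?thesis by (simp add: w_def)
        qed
        ultimately show ?thesis using 2 8 True
          by (simp add: omega_def w w_def[symmetric] t mult.commute[of 2])
      qed
    qed (simp add: omega_def w w_def[symmetric])
  next
    case False
    then have "\<not> omega q m dvd t" by (auto simp: omega_def w_def[symmetric] dest: dvd_mult_right)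
    then show ?thesis using False by (simp add: w)
  qed
qed

text \<open>The criterion in \<open>omega_dvd_iff\<close> only becomes weaker when the modulus is
  replaced by a divisor.\<close>

lemma omega_dvd_mono:
  assumes "m > 0" "coprime m q" "m' dvd m" "omega q m dvd t"
  shows "omega q m' dvd t"
proof -
  have m': "m' > 0" "coprime m' q"
    using assms(1,3) coprime_divisors[OF assms(3) dvd_refl assms(2)] by (auto intro: Nat.gr0I)
  have "p dvd rad m" if "prime p" "p dvd m" for p
    using that rad_dvd_iff[OF assms(1), THEN iffD1, OF dvd_refl] by blast
  then have "rad m' dvd rad m"
    using rad_dvd_iff[OF m'(1)] assms(3) by (meson dvd_trans)
  moreover have "8 dvd m" if "8 dvd m'" using that assms(3) by (rule dvd_trans)
  ultimately show ?thesis
    using assms(4) cong_dvd_modulus_nat unfolding omega_dvd_iff[OF assms(1,2)] omega_dvd_iff[OF m']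
    by blast
qed

text \<open>The power is 1 modulo \<open>m\<close>, hence modulo \<open>rad m\<close>, and modulo 4
  if 8 divides \<open>m\<close>. Later this lets parameters be reduced by a gcd with the period
  without losing divisibility by \<open>omega\<close>.\<close>

lemma omega_dvd_ord:
  assumes "m > 0" "coprime m q"
  shows "omega q m dvd ord m q"
proof -
  have 1: "[q ^ ord m q = 1] (mod m)" by (rule ord)
  have "rad m dvd m" using rad_dvd_iff[OF assms(1)] by blast
  then have "[q ^ ord m q = 1] (mod rad m)" using 1 cong_dvd_modulus_nat by blast
  moreover have "\<not> [q ^ ord m q = 3] (mod 4)" if "8 dvd m"
  proof -
    have "4 dvd m" using that by (rule dvd_trans[rotated]) simp
    then have "[q ^ ord m q = 1] (mod 4)" using 1 cong_dvd_modulus_nat by blast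
    then show ?thesis by (simp add: cong_def)
  qed
  ultimately show ?thesis unfolding omega_dvd_iff[OF assms] by blast
qed

lemma ord_dvd_mono:
  fixes m m' q :: nat
  assumes "m' dvd m"
  shows "ord m' q dvd ord m q"
  using cong_dvd_modulus_nat[OF ord assms] unfolding ord_divides .

section \<open>Cyclotomic cosets and equal-difference sets\<close>

text \<open>Cancel the gcd, then the cofactor of \<open>\<gamma>\<close>, which is a unit for the
  remaining modulus. Thus a coset modulo \<open>n\<close> is governed by orders modulo
  \<open>n div gcd \<gamma> n\<close>.\<close>

lemma mult_cong_mult_iff:
  fixes \<gamma> n x y :: nat
  assumes "n > 0"
  shows "[\<gamma> * x = \<gamma> * y] (mod n) \<longleftrightarrow> [x = y] (mod (n div gcd \<gamma> n))"
proof -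
  define g where "g = gcd \<gamma> n"
  have "g > 0" using assms by (simp add: g_def)
  then obtain c m where *: "\<gamma> = c * g" "n = m * g" "coprime c m"
    using gcd_coprime_exists[of \<gamma> n] unfolding g_def[symmetric] by blast
  have "[\<gamma> * x = \<gamma> * y] (mod n) \<longleftrightarrow> [c * x = c * y] (mod m)"
    using \<open>g > 0\<close> by (simp add: * cong_def mult.assoc mult.left_commute[of c g] mult.commute[of m g])
  also have "\<dots> \<longleftrightarrow> [x = y] (mod m)" using *(3) by (rule cong_mult_lcancel_nat)
  also have "m = n div g" using \<open>g > 0\<close> * by simp
  finally show ?thesis by (simp add: g_def)
qed

lemma div_gcd_dvd: "n div gcd \<gamma> n dvd (n :: nat)"
  by (metis dvd_div_mult_self dvd_triv_left gcd_dvd2)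

lemma coprime_div_gcd:
  fixes \<gamma> n N :: nat
  assumes "coprime n N"
  shows "coprime (n div gcd \<gamma> n) N"
  by (rule coprime_divisors[OF div_gcd_dvd dvd_refl assms])

lemma mult_power_cong_iff:
  fixes \<gamma> n N :: nat
  assumes "n > 0" "coprime n N"
  shows "[\<gamma> * N ^ a = \<gamma> * N ^ b] (mod n) \<longleftrightarrow> [a = b] (mod (ord (n div gcd \<gamma> n) N))"
  using assms by (simp add: mult_cong_mult_iff order_divides_expdiff coprime_div_gcd)

lemma coset_period_eq_ord:
  assumes "n > 0" "coprime n N"
  shows "coset_period n N \<gamma> = ord (n div gcd \<gamma> n) N"
proof -
  have *: "[\<gamma> * N ^ \<sigma> = \<gamma>] (mod n) \<longleftrightarrow> ord (n div gcd \<gamma> n) N dvd \<sigma>" for \<sigma>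
    using mult_power_cong_iff[OF assms, of \<gamma> \<sigma> 0] by (simp add: cong_0_iff)
  show ?thesis unfolding coset_period_def *
    by (rule Least_equality) (use coprime_div_gcd[OF assms(2)] in \<open>auto intro: dvd_imp_le\<close>)
qed

lemma cyc_coset_eq_range:
  assumes "n > 0" "coprime n N"
  shows "cyc_coset n N \<gamma> = range (\<lambda>j. \<gamma> * N ^ j mod n)"
proof -
  define w where "w = ord (n div gcd \<gamma> n) N"
  have w: "w > 0" using coprime_div_gcd[OF assms(2)] by (simp add: w_def)
  have "\<gamma> * N ^ j mod n = \<gamma> * N ^ (j mod w) mod n" for j
    using mult_power_cong_iff[OF assms, of \<gamma> j "j mod w"] by (simp add: cong_def w_def)
  then show ?thesis
    unfolding cyc_coset_def coset_period_eq_ord[OF assms] w_def[symmetric] using w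
    by (auto intro!: image_eqI[of _ _ "_ mod w"])
qed

lemma card_cyc_coset:
  assumes "n > 0" "coprime n N"
  shows "card (cyc_coset n N \<gamma>) = ord (n div gcd \<gamma> n) N"
    and "inj_on (\<lambda>j. \<gamma> * N ^ j mod n) {..<ord (n div gcd \<gamma> n) N}"
proof -
  show inj: "inj_on (\<lambda>j. \<gamma> * N ^ j mod n) {..<ord (n div gcd \<gamma> n) N}"
  proof (rule inj_onI)
    fix a b assume ab: "a \<in> {..<ord (n div gcd \<gamma> n) N}" "b \<in> {..<ord (n div gcd \<gamma> n) N}"
      "\<gamma> * N ^ a mod n = \<gamma> * N ^ b mod n"
    then have "[a = b] (mod (ord (n div gcd \<gamma> n) N))"
      using mult_power_cong_iff[OF assms] by (simp add: cong_def)
    then show "a = b" using ab by (simp add: cong_def)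
  qed
  show "card (cyc_coset n N \<gamma>) = ord (n div gcd \<gamma> n) N"
    unfolding cyc_coset_def coset_period_eq_ord[OF assms] using card_image[OF inj] by simp
qed

lemma cyc_coset_mod:
  assumes "n > 0" "coprime n N"
  shows "cyc_coset n N (\<gamma> mod n) = cyc_coset n N \<gamma>"
  by (simp add: cyc_coset_eq_range[OF assms] mod_mult_left_eq)

lemma cyc_coset_subset:
  assumes "n > 0"
  shows "cyc_coset n N \<gamma> \<subseteq> {..<n}"
  using assms by (auto simp: cyc_coset_def)

lemma mod_in_cyc_coset:
  assumes "n > 0" "coprime n N"
  shows "\<gamma> mod n \<in> cyc_coset n N \<gamma>"
  unfolding cyc_coset_eq_range[OF assms] by (rule range_eqI[of _ _ 0]) simp

text \<open>Cosets are orbits under multiplication by the unit \<open>N\<close>, so every element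
  generates its orbit.\<close>

lemma cyc_coset_eq:
  assumes "n > 0" "coprime n N" "e \<in> cyc_coset n N \<gamma>"
  shows "cyc_coset n N e = cyc_coset n N \<gamma>"
proof -
  define w where "w = ord (n div gcd \<gamma> n) N"
  have w: "w > 0" using coprime_div_gcd[OF assms(2)] by (simp add: w_def)
  obtain i where e: "e = \<gamma> * N ^ i mod n" using assms by (auto simp: cyc_coset_eq_range)
  have *: "e * N ^ j mod n = \<gamma> * N ^ (i + j) mod n" for j
    by (simp add: e mod_mult_left_eq power_add mult.assoc)
  \<comment> \<open>The exponent is chosen so that adding \<open>i\<close> yields
    \<open>j + i * w\<close>, which is \<open>j\<close> modulo the period.\<close>
  have "\<gamma> * N ^ j mod n = e * N ^ (j + i * (w - 1)) mod n" for j
  proof -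
    have "i + (j + i * (w - 1)) = j + i * w" using w by (cases w) auto
    then have "[j = i + (j + i * (w - 1))] (mod w)" by (simp only: cong_def mod_mult_self1)
    then show ?thesis
      unfolding * using mult_power_cong_iff[OF assms(1,2)] by (simp add: cong_def w_def)
  qed
  then show ?thesis unfolding cyc_coset_eq_range[OF assms(1,2)] using * by auto
qed

text \<open>Multiplication by a unit preserves the gcd with the modulus. Hence all elements of a
  coset have the same reduced modulus and the same \<open>omega\<close>.\<close>

lemma gcd_cyc_coset:
  assumes "n > 0" "coprime n N" "e \<in> cyc_coset n N \<gamma>"
  shows "gcd e n = gcd \<gamma> n"
proof -
  obtain i where e: "e = \<gamma> * N ^ i mod n" using assms by (auto simp: cyc_coset_eq_range)
  have "gcd e n = gcd (N ^ i * \<gamma>) n" using assms(1) by (simp add: e mult.commute gcd_mod_left)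
  also have "\<dots> = gcd \<gamma> n"
    using assms(2) by (intro gcd_mult_left_left_cancel) (simp add: coprime_commute)
  finally show ?thesis .
qed

section \<open>Arithmetic progressions as residue classes\<close>

lemma card_residue_class:
  fixes n \<delta> e :: nat
  assumes "n > 0" "\<delta> dvd n"
  shows "card {x. x < n \<and> [x = e] (mod \<delta>)} = n div \<delta>"
proof -
  have \<delta>: "\<delta> > 0" using assms by (auto intro: Nat.gr0I)
  obtain k where n: "n = k * \<delta>" using assms(2) by (metis dvdE mult.commute)
  have "bij_betw (\<lambda>j. j * \<delta> + e mod \<delta>) {..<k} {x. x < n \<and> [x = e] (mod \<delta>)}"
  proof (rule bij_betwI[where g = "\<lambda>x. x div \<delta>"])
    show "(\<lambda>j. j * \<delta> + e mod \<delta>) \<in> {..<k} \<rightarrow> {x. x < n \<and> [x = e] (mod \<delta>)}"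
    proof
      fix j assume "j \<in> {..<k}"
      then have "Suc j * \<delta> \<le> n" unfolding n by (intro mult_le_mono1) auto
      moreover have "e mod \<delta> < \<delta>" using \<delta> by simp
      ultimately show "j * \<delta> + e mod \<delta> \<in> {x. x < n \<and> [x = e] (mod \<delta>)}"
        by (simp add: cong_def)
    qed
    show "(\<lambda>x. x div \<delta>) \<in> {x. x < n \<and> [x = e] (mod \<delta>)} \<rightarrow> {..<k}"
      by (auto simp: n less_mult_imp_div_less)
    show "(j * \<delta> + e mod \<delta>) div \<delta> = j" for j using \<delta> by simp
    show "x div \<delta> * \<delta> + e mod \<delta> = x" if "x \<in> {x. x < n \<and> [x = e] (mod \<delta>)}" for x
      using that div_mult_mod_eq[of x \<delta>] by (simp add: cong_def)
  qed
  from bij_betw_same_card[OF this] show ?thesis using \<delta> by (simp add: n)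
qed

text \<open>All terms of the progression are congruent to \<open>e\<close>, and both sides have
  \<open>k\<close> elements.\<close>

lemma arith_progression_eq_residue_class:
  fixes n k e :: nat
  assumes "n > 0" "k dvd n"
  shows "(\<lambda>i. (e + i * (n div k)) mod n) ` {..<k} = {x. x < n \<and> [x = e] (mod (n div k))}"
proof (rule card_subset_eq)
  have k: "k > 0" using assms by (auto intro: Nat.gr0I)
  obtain d where n: "n = k * d" using assms(2) by blast
  have d: "d > 0" "n div k = d" using assms(1) k by (auto simp: n)
  have "d dvd n" by (simp add: n)
  then have "[(e + i * d) mod n = e] (mod d)" for i
    by (simp add: cong_def mod_mod_cancel)
  then show "(\<lambda>i. (e + i * (n div k)) mod n) ` {..<k} \<subseteq> {x. x < n \<and> [x = e] (mod (n div k))}"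
    using assms(1) d by auto
  have "inj_on (\<lambda>i. (e + i * d) mod n) {..<k}"
  proof (rule inj_onI)
    fix i j assume ij: "i \<in> {..<k}" "j \<in> {..<k}" "(e + i * d) mod n = (e + j * d) mod n"
    then have "[e + i * d = e + j * d] (mod n)" by (simp add: cong_def)
    then have "[i * d = j * d] (mod n)" by (simp add: cong_add_lcancel_nat)
    then show "i = j" using ij d by (simp add: cong_def n)
  qed
  then have "card ((\<lambda>i. (e + i * d) mod n) ` {..<k}) = k" by (simp add: card_image)
  moreover have "n div d = k" using d by (simp add: n)
  ultimately show "card ((\<lambda>i. (e + i * (n div k)) mod n) ` {..<k}) = card {x. x < n \<and> [x = e] (mod (n div k))}"
    using card_residue_class[OF assms(1) \<open>d dvd n\<close>] d by simp
qed simp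

text \<open>A full residue class has no distinguished starting point, so the existentially
  quantified start can be replaced by any given element.\<close>

lemma equal_difference_iff_residue_class:
  assumes "n > 0" "e \<in> E"
  shows "equal_difference n E \<longleftrightarrow>
    card E dvd n \<and> E = {x. x < n \<and> [x = e] (mod (n div card E))}"
proof -
  let ?C = "\<lambda>e. {x. x < n \<and> [x = e] (mod (n div card E))}"
  have "E = ?C e" if "E = ?C f" "f \<in> E" for f
  proof -
    have "[e = f] (mod (n div card E))" using that(1) assms(2) by blast
    then have "?C e = ?C f" by (auto simp: cong_def)
    then show ?thesis using that(1) by simp
  qed
  moreover have "equal_difference n E \<longleftrightarrow> card E dvd n \<and> (\<exists>f\<in>E. E = ?C f)"
    unfolding equal_difference_def
    by (intro conj_cong refl bex_cong) (simp only: arith_progression_eq_residue_class[OF assms(1)])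
  ultimately show ?thesis using assms(2) by blast
qed

section \<open>When a cyclotomic coset is an equal-difference set\<close>

text \<open>After division by \<open>g\<close>, every \<open>c + k * d\<close> is some
  \<open>c * Q ^ j\<close> modulo \<open>m\<close>, hence a unit. If a prime divisor of
  \<open>m\<close> did not divide \<open>d\<close>, it would divide some \<open>c + k * d\<close>;
  so \<open>rad m\<close> divides \<open>d\<close>, and \<open>Q\<close> is 1 modulo
  \<open>d\<close>. The exceptional case is refuted modulo 8.\<close>

lemma equal_difference_cyc_coset_imp:
  assumes n: "n > 0" "coprime n Q" and ed: "equal_difference n (cyc_coset n Q e)"
  defines "m \<equiv> n div gcd e n"
  shows "[Q = 1] (mod rad m) \<and> \<not> (8 dvd m \<and> [Q = 3] (mod 4))"
proof -
  define g where "g = gcd e n"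
  define E where "E = cyc_coset n Q e"
  define \<sigma> where "\<sigma> = card E"
  define \<delta> where "\<delta> = n div \<sigma>"
  have g: "g > 0" using n by (simp add: g_def)
  obtain c where e: "e = g * c" and n_eq: "n = g * m" and "coprime c m"
  proof -
    obtain c m' where *: "e = c * g" "n = m' * g" "coprime c m'"
      using gcd_coprime_exists[of e n] g unfolding g_def[symmetric] by blast
    then have "n div g = m'" using g by simp
    then have "m = m'" by (simp add: m_def g_def)
    then show thesis using * that[of c] by (simp add: mult.commute)
  qed
  have "m > 0" using n n_eq by simp
  have "coprime m Q" unfolding m_def by (rule coprime_div_gcd[OF n(2)])
  have "e mod n \<in> E" unfolding E_def by (rule mod_in_cyc_coset[OF n])
  then have \<sigma>: "\<sigma> dvd n" and E: "E = {x. x < n \<and> [x = e mod n] (mod \<delta>)}"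
    using ed equal_difference_iff_residue_class[OF n(1)] unfolding E_def[symmetric] \<sigma>_def \<delta>_def by blast+
  have n\<delta>: "n = \<delta> * \<sigma>" using \<sigma> by (simp add: \<delta>_def)
  have mod\<delta>: "[x mod n = x] (mod \<delta>)" for x
    by (simp add: n\<delta> cong_def mod_mod_cancel)
  have step: "\<exists>j. [e + k * \<delta> = e * Q ^ j] (mod n)" for k
  proof -
    have "[(e + k * \<delta>) mod n = e + k * \<delta>] (mod \<delta>)" by (rule mod\<delta>)
    also have "[e + k * \<delta> = e] (mod \<delta>)" by (simp add: cong_def)
    also have "[e = e mod n] (mod \<delta>)" using mod\<delta> cong_sym by blast
    finally have "(e + k * \<delta>) mod n \<in> E" using n(1) by (simp add: E)
    then show ?thesis by (auto simp: E_def cyc_coset_eq_range[OF n] cong_def)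
  qed
  \<comment> \<open>The next term \<open>e + \<delta>\<close> is congruent to a coset element and
    hence a multiple of \<open>g\<close>, as is \<open>e\<close>.\<close>
  have "g dvd \<delta>"
  proof -
    obtain j where j: "[e + 1 * \<delta> = e * Q ^ j] (mod n)" using step by blast
    have "[e + \<delta> = e * Q ^ j] (mod g)"
      using cong_dvd_modulus_nat[OF j, of g] n_eq by simp
    then have "g dvd e + \<delta> \<longleftrightarrow> g dvd e * Q ^ j" by (rule cong_dvd_iff)
    then show ?thesis using dvd_add_right_iff[of g "g * c" \<delta>] by (simp add: e)
  qed
  then obtain d where \<delta>: "\<delta> = g * d" by blast
  have m: "m = d * \<sigma>" using n_eq n\<delta> \<delta> g by simp
  have step': "\<exists>j. [c + k * d = c * Q ^ j] (mod m)" for k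
  proof -
    obtain j where "[e + k * \<delta> = e * Q ^ j] (mod n)" using step by blast
    then have "[g * (c + k * d) = g * (c * Q ^ j)] (mod (g * m))"
      by (simp add: e \<delta> n_eq algebra_simps)
    then show ?thesis using g by (auto simp: cong_def)
  qed
  have prime_d: "p dvd d" if p: "prime p" "p dvd m" for p
  proof (rule ccontr)
    assume "\<not> p dvd d"
    then have "coprime d p" using p(1) using prime_imp_coprime coprime_commute by blast
    then obtain x where x: "[d * x = 1] (mod p)" using cong_solve_coprime_nat by auto
    \<comment> \<open>This \<open>k\<close> makes \<open>c + k * d\<close> vanish modulo
      \<open>p\<close>: as \<open>x\<close> inverts \<open>d\<close>, the product
      \<open>k * d\<close> becomes \<open>c * (p - 1)\<close>, which stands for
      \<open>- c\<close>.\<close>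
    define k where "k = x * c * (p - 1)"
    have "[k * d = c * (p - 1)] (mod p)"
      using cong_mult[OF x cong_refl[of "c * (p - 1)"]] by (simp add: k_def ac_simps)
    then have "[c + k * d = c + c * (p - 1)] (mod p)" by (simp add: cong_add_lcancel_nat)
    moreover have "c + c * (p - 1) = c * p"
      using prime_gt_0_nat[OF p(1)] by (cases p) auto
    ultimately have "p dvd c + k * d" by (simp add: cong_dvd_iff)
    moreover obtain j where j: "[c + k * d = c * Q ^ j] (mod m)" using step' by blast
    have "[c + k * d = c * Q ^ j] (mod p)" using j p(2) by (rule cong_dvd_modulus_nat)
    ultimately have "p dvd c * Q ^ j" by (simp add: cong_dvd_iff)
    then have "p dvd c \<or> p dvd Q" using p(1) by (metis prime_dvd_mult_iff prime_dvd_power)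
    then show False
      using p \<open>coprime c m\<close> \<open>coprime m Q\<close> by (meson coprime_common_divisor not_prime_unit)
  qed
  have Qd: "[Q = 1] (mod d)"
  proof -
    have "e * Q mod n \<in> E"
      unfolding E_def cyc_coset_eq_range[OF n] by (rule range_eqI[of _ _ 1]) simp
    then have "[e * Q mod n = e mod n] (mod \<delta>)" by (simp add: E)
    then have "[e * Q = e] (mod \<delta>)" using mod\<delta> by (meson cong_sym cong_trans)
    then have "[g * (c * Q) = g * c] (mod (g * d))" by (simp add: e \<delta> mult.assoc)
    then have "[c * Q = c * 1] (mod d)" using g by (simp add: cong_def)
    moreover have "coprime c d" using \<open>coprime c m\<close> by (simp add: m)
    ultimately show ?thesis using cong_mult_lcancel_nat by blast
  qed
  have "rad m dvd d" using prime_d rad_dvd_iff[OF \<open>m > 0\<close>] by blast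
  then have "[Q = 1] (mod rad m)" using Qd cong_dvd_modulus_nat by blast
  moreover have False if "8 dvd m" "[Q = 3] (mod 4)"
  proof -
    have "even d" using that(1) by (intro prime_d) auto
    then obtain d' where d': "d = 2 * d'" by blast
    have "odd d'"
    proof
      assume "even d'"
      then have "4 dvd d" using d' by auto
      then have "[Q = 1] (mod 4)" using Qd cong_dvd_modulus_nat by blast
      then show False using that(2) by (simp add: cong_def)
    qed
    have "even m" using that(1) by auto
    then have "odd c" using \<open>coprime c m\<close> by auto
    \<comment> \<open>As \<open>d\<close> is twice an odd number, the term for \<open>k = 2\<close>
      is \<open>c + 4\<close> modulo 8. For odd \<open>c\<close> this would force
      \<open>Q ^ j\<close> to be 5 modulo 8, but powers of \<open>Q\<close> are 1 or
      \<open>r\<close> there, with \<open>r\<close> equal to 3 or 7.\<close>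
    obtain j where j: "[c + 2 * d = c * Q ^ j] (mod m)" using step' by blast
    define r where "r = Q mod 8"
    have "r mod 4 = 3" "r < 8" using that(2) by (simp_all add: r_def cong_def mod_mod_cancel)
    then have r: "r = 3 \<or> r = 7" by presburger
    have Qj: "Q ^ j mod 8 = 1 \<or> Q ^ j mod 8 = r"
    proof (induction j)
      case (Suc j)
      have "r * x mod 8 = 1 \<or> r * x mod 8 = r" if "x = 1 \<or> x = r" for x
        using that r by auto
      from this[OF Suc] show ?case by (simp only: power_Suc r_def mod_mult_eq)
    qed simp
    define a where "a = c mod 8"
    have a: "a = 1 \<or> a = 3 \<or> a = 5 \<or> a = 7"
      unfolding a_def using \<open>odd c\<close> by presburger
    have "[c + 2 * d = c * Q ^ j] (mod 8)" using j that(1) by (rule cong_dvd_modulus_nat)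
    moreover have "[c + 2 * d = c + 4] (mod 8)"
    proof -
      obtain r where "d' = 2 * r + 1" using \<open>odd d'\<close> by (blast elim: oddE)
      then have "c + 2 * d = c + 4 + r * 8" by (simp add: d')
      then show ?thesis by (simp only: cong_def mod_mult_self1)
    qed
    ultimately have "(c + 4) mod 8 = c * Q ^ j mod 8" by (simp add: cong_def)
    then have "(a + 4) mod 8 = a * (Q ^ j mod 8) mod 8"
      by (simp add: a_def mod_mult_eq mod_add_left_eq)
    then show False using a Qj r by auto
  qed
  ultimately show ?thesis by blast
qed

text \<open>With \<open>d = gcd (Q - 1) m\<close>, the coset lies in the residue class of
  \<open>e\<close> modulo \<open>g * d\<close>, which has \<open>s = m div d\<close> elements.
  Lifting the exponent gives \<open>m dvd \<sigma> * (Q - 1)\<close>, hence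
  \<open>s dvd \<sigma>\<close>, so the coset fills the class.\<close>

lemma equal_difference_cyc_coset_if:
  fixes n Q e :: nat
  assumes n: "n > 0" "coprime n Q" and Q: "Q > 0"
  defines "m \<equiv> n div gcd e n"
  assumes rad: "[Q = 1] (mod rad m)" and 8: "\<not> (8 dvd m \<and> [Q = 3] (mod 4))"
  shows "equal_difference n (cyc_coset n Q e)"
proof -
  define g where "g = gcd e n"
  define E where "E = cyc_coset n Q e"
  define \<sigma> where "\<sigma> = card E"
  have g: "g > 0" using n by (simp add: g_def)
  have n_eq: "n = g * m" by (simp add: m_def g_def)
  have "m > 0" using n n_eq by simp
  define d where "d = gcd (Q - 1) m"
  define s where "s = m div d"
  have m: "m = d * s" by (simp add: s_def d_def)
  have "d > 0" "s > 0" using \<open>m > 0\<close> m by auto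
  have "\<sigma> = ord m Q" by (simp add: \<sigma>_def E_def card_cyc_coset[OF n] m_def)
  then have \<sigma>: "\<sigma> > 0" "[Q ^ \<sigma> = 1] (mod m)"
    using coprime_div_gcd[OF n(2)] ord[of Q m] by (simp_all add: m_def)
  \<comment> \<open>The lifting lemma lives in the integers; \<open>Q > 0\<close> makes the
    truncated subtraction exact.\<close>
  have Q1: "int (Q - 1) = int Q - 1" using Q by simp
  have "p dvd int Q - 1" if "prime p" "p dvd int m" for p
  proof -
    have "p \<ge> 0" using that(1) prime_ge_0_int by blast
    then obtain r where p: "p = int r" using nonneg_int_cases by blast
    have "r dvd rad m" using that rad_dvd_iff[OF \<open>m > 0\<close>, of "rad m"] by (simp add: p)
    then have "[Q = 1] (mod r)" using rad cong_dvd_modulus_nat by blast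
    then show ?thesis using Q by (simp add: p Q1[symmetric] cong_altdef_nat' del: of_nat_diff)
  qed
  moreover have "\<not> (8 dvd int m \<and> [int Q = 3] (mod 4))"
    using 8 cong_int_iff[of Q 3 4] int_dvd_int_iff[of 8 m] by auto
  moreover have "int m dvd int Q ^ \<sigma> - 1"
    using \<sigma>(2) cong_int_iff[of "Q ^ \<sigma>" 1 m] by (simp add: cong_iff_dvd_diff)
  ultimately have "int m dvd int \<sigma> * int (Q - 1)"
    unfolding Q1 using \<open>m > 0\<close> by (intro dvd_mult_pred_if_dvd_power_pred') auto
  then have mQ: "m dvd \<sigma> * (Q - 1)" unfolding of_nat_mult[symmetric] int_dvd_int_iff .
  have "s dvd \<sigma>"
  proof -
    have "d dvd Q - 1" by (simp add: d_def)
    then obtain u where u: "Q - 1 = d * u" by blast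
    \<comment> \<open>Division of \<open>Q - 1\<close> and \<open>m\<close> by their gcd leaves
      coprime cofactors, so \<open>u\<close> cancels from \<open>s dvd \<sigma> * u\<close>.\<close>
    have "coprime s u"
    proof -
      have "d * gcd u s = gcd (d * u) (d * s)" by (rule gcd_mult_distrib_nat)
      also have "\<dots> = d" by (simp only: u[symmetric] m[symmetric] d_def[symmetric])
      finally have "gcd u s = 1" using \<open>d > 0\<close> by (metis mult.right_neutral mult_left_cancel not_gr0)
      then show ?thesis by (simp only: coprime_iff_gcd_eq_1 gcd.commute)
    qed
    moreover have "s dvd \<sigma> * u"
      using mQ u m \<open>d > 0\<close> by (simp add: mult.left_commute)
    ultimately show ?thesis by (simp add: coprime_dvd_mult_left_iff)
  qed
  then have "s \<le> \<sigma>" using \<sigma>(1) by (simp add: dvd_imp_le)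
  define C where "C = {x. x < n \<and> [x = e mod n] (mod (g * d))}"
  have gd: "g * d dvd n" "n div (g * d) = s"
    using g \<open>d > 0\<close> by (simp_all add: n_eq m)
  have "card C = s" unfolding C_def using card_residue_class[OF n(1) gd(1)] gd(2) by simp
  have "E \<subseteq> C"
  proof
    fix x assume "x \<in> E"
    then obtain j where x: "x = e * Q ^ j mod n"
      by (auto simp: E_def cyc_coset_eq_range[OF n])
    have "[1 + (Q - 1) = 1 + 0] (mod d)"
      by (intro cong_add cong_refl) (simp add: cong_0_iff d_def)
    then have "[Q = 1] (mod d)" using Q by simp
    then have "[Q ^ j = 1 ^ j] (mod d)" by (rule cong_pow)
    then have "[g * Q ^ j = g] (mod (g * d))" by (simp add: cong_def)
    then have "[e div g * (g * Q ^ j) = e div g * g] (mod (g * d))" by (intro cong_mult cong_refl)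
    moreover have "e div g * g = e" by (simp add: g_def)
    ultimately have "[e * Q ^ j = e] (mod (g * d))" by (metis mult.assoc)
    then show "x \<in> C" using gd(1) n(1) by (simp add: C_def x cong_def mod_mod_cancel)
  qed
  moreover have "finite C" by (simp add: C_def)
  ultimately have "E = C" and "\<sigma> = s"
    using card_mono[of C E] card_subset_eq[of C E] \<open>card C = s\<close> \<open>s \<le> \<sigma>\<close> by (simp_all add: \<sigma>_def)
  have "n div s = g * d" using \<open>s > 0\<close> by (simp add: n_eq m)
  have "card E dvd n" using \<open>\<sigma> = s\<close> by (simp add: \<sigma>_def n_eq m)
  moreover have "E = {x. x < n \<and> [x = e mod n] (mod (n div card E))}"
    using \<open>E = C\<close> \<open>\<sigma> = s\<close> \<open>n div s = g * d\<close> by (simp add: \<sigma>_def C_def)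
  ultimately show ?thesis
    using equal_difference_iff_residue_class[OF n(1) mod_in_cyc_coset[OF n]] unfolding E_def by blast
qed

lemma equal_difference_cyc_coset_iff:
  assumes "n > 0" "coprime n q" "q > 0"
  shows "equal_difference n (cyc_coset n (q ^ t) e) \<longleftrightarrow> omega q (n div gcd e n) dvd t"
proof -
  have "coprime n (q ^ t)" using assms by simp
  moreover have "n div gcd e n > 0" using assms(1) by (simp add: div_greater_zero_iff)
  ultimately show ?thesis
    using equal_difference_cyc_coset_imp[of n "q ^ t" e] equal_difference_cyc_coset_if[of n "q ^ t" e]
      omega_dvd_iff[of "n div gcd e n" q t] coprime_div_gcd[OF assms(2)] assms by auto
qed

section \<open>Cyclotomic decompositions\<close>

lemma coprime_powerI:
  "coprime n (q ^ t)" if "coprime n (q :: nat)"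
  using that by simp

text \<open>In a cyclic group of order \<open>\<tau>\<close>, a \<open>t\<close>-th power of a
  generator and its power with exponent \<open>gcd t \<tau>\<close> generate the same subgroup.
  Bezout supplies the harder inclusion.\<close>

lemma cyc_coset_power_gcd:
  assumes n: "n > 0" "coprime n q" and t: "t > 0"
  shows "cyc_coset n (q ^ t) e = cyc_coset n (q ^ gcd t (ord (n div gcd e n) q)) e"
proof -
  define \<tau> where "\<tau> = ord (n div gcd e n) q"
  obtain u v where uv: "t * u = \<tau> * v + gcd t \<tau>" using bezout_nat[of t \<tau>] t by blast
  have "e * (q ^ t) ^ j mod n = e * (q ^ gcd t \<tau>) ^ (t div gcd t \<tau> * j) mod n" for j
    by (simp add: power_mult[symmetric] mult.assoc[symmetric])
  moreover have "e * (q ^ gcd t \<tau>) ^ j mod n = e * (q ^ t) ^ (u * j) mod n" for j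
  proof -
    have "t * (u * j) = gcd t \<tau> * j + v * j * \<tau>"
      using arg_cong[OF uv, of "\<lambda>x. x * j"] by (simp add: algebra_simps)
    then have "[t * (u * j) = gcd t \<tau> * j] (mod \<tau>)" by (simp add: cong_def)
    then show ?thesis
      using mult_power_cong_iff[OF n, of e] by (simp add: power_mult[symmetric] cong_def \<tau>_def)
  qed
  ultimately show ?thesis
    using n by (auto simp: cyc_coset_eq_range \<tau>_def)
qed

text \<open>Some multiple of \<open>t\<close> is congruent to \<open>d = gcd t \<tau>\<close> modulo
  \<open>\<tau>\<close>, so moving the exponent of \<open>q\<close> by \<open>d\<close> stays in the
  same block. The resulting description needs neither indices nor a representative of the
  coset.\<close>

lemma cyc_decomp_eq_image:
  assumes n: "n > 0" "coprime n q" and t: "t > 0"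
  shows "cyc_decomp n q t \<gamma> = cyc_coset n (q ^ t) ` cyc_coset n q \<gamma>"
proof -
  define \<tau> where "\<tau> = ord (n div gcd \<gamma> n) q"
  have \<tau>: "card (cyc_coset n q \<gamma>) = \<tau>" by (simp add: card_cyc_coset[OF n] \<tau>_def)
  note nt = n(1) coprime_powerI[OF n(2), of t]
  define d where "d = gcd t \<tau>"
  have d: "d > 0" using t by (simp add: d_def)
  obtain u v where uv: "t * u = \<tau> * v + d" using bezout_nat[of t \<tau>] t unfolding d_def by blast
  have shift: "cyc_coset n (q ^ t) (\<gamma> * q ^ j) = cyc_coset n (q ^ t) (\<gamma> * q ^ (j mod d))" for j
  proof -
    have "j mod d + t * (u * (j div d)) = (j mod d + j div d * d) + v * (j div d) * \<tau>"
      using arg_cong[OF uv, of "\<lambda>x. x * (j div d)"] by (simp add: algebra_simps)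
    then have "[j = j mod d + t * (u * (j div d))] (mod \<tau>)"
      by (simp add: cong_def)
    then have "\<gamma> * q ^ j mod n = \<gamma> * q ^ (j mod d) * (q ^ t) ^ (u * (j div d)) mod n"
      using mult_power_cong_iff[OF n, of \<gamma>]
      by (simp add: power_mult[symmetric] power_add[symmetric] mult.assoc cong_def \<tau>_def)
    then have "\<gamma> * q ^ j mod n \<in> cyc_coset n (q ^ t) (\<gamma> * q ^ (j mod d))"
      by (simp add: cyc_coset_eq_range[OF nt])
    from cyc_coset_eq[OF nt this] show ?thesis by (simp add: cyc_coset_mod[OF nt])
  qed
  have "cyc_decomp n q t \<gamma> = (\<lambda>j. cyc_coset n (q ^ t) (\<gamma> * q ^ j)) ` {..<d}"
    by (simp add: cyc_decomp_def \<tau> d_def)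
  also have "\<dots> = range (\<lambda>j. cyc_coset n (q ^ t) (\<gamma> * q ^ j))"
    using shift d by (auto intro!: image_eqI[of _ _ "_ mod d"])
  also have "\<dots> = cyc_coset n (q ^ t) ` cyc_coset n q \<gamma>"
    unfolding cyc_coset_eq_range[OF n, of \<gamma>] image_image cyc_coset_mod[OF nt] ..
  finally show ?thesis .
qed

text \<open>Admitting any multiple \<open>T\<close> of the period lets \<open>ord n q\<close> serve
  for all cosets at once.\<close>

lemma cyc_decomp_gcd:
  assumes n: "n > 0" "coprime n q" and t: "t > 0" and "ord (n div gcd \<gamma> n) q dvd T"
  shows "cyc_decomp n q (gcd t T) \<gamma> = cyc_decomp n q t \<gamma>"
proof -
  have "cyc_coset n (q ^ gcd t T) e = cyc_coset n (q ^ t) e" if "e \<in> cyc_coset n q \<gamma>" for e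
  proof -
    have e: "gcd e n = gcd \<gamma> n" using gcd_cyc_coset[OF n that] .
    have "gcd (gcd t T) (ord (n div gcd \<gamma> n) q) = gcd t (ord (n div gcd \<gamma> n) q)"
      using assms(4) by (simp add: gcd.assoc gcd_proj2_if_dvd_nat)
    then show ?thesis
      using cyc_coset_power_gcd[OF n, of "gcd t T" e] cyc_coset_power_gcd[OF n t, of e] t
      by (simp add: e)
  qed
  then show ?thesis using t by (simp add: cyc_decomp_eq_image[OF n])
qed

lemma cyc_coset_power_subset:
  assumes n: "n > 0" "coprime n q" and "s dvd t"
  shows "cyc_coset n (q ^ t) e \<subseteq> cyc_coset n (q ^ s) e"
proof -
  obtain r where "t = s * r" using assms(3) by blast
  then have "(q ^ t) ^ j = (q ^ s) ^ (r * j)" for j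
    by (simp add: power_mult[symmetric] mult.assoc)
  then show ?thesis
    using n by (auto simp: cyc_coset_eq_range)
qed

text \<open>The case \<open>s = 1\<close> gives the covering property of a decomposition, general
  \<open>s\<close> the splitting of its blocks.\<close>

lemma Union_cyc_coset:
  assumes n: "n > 0" "coprime n q" and "s dvd t"
  shows "(\<Union>e\<in>cyc_coset n (q ^ s) \<gamma>. cyc_coset n (q ^ t) e) = cyc_coset n (q ^ s) \<gamma>"
proof
  note ns = n(1) coprime_powerI[OF n(2), of s]
  show "(\<Union>e\<in>cyc_coset n (q ^ s) \<gamma>. cyc_coset n (q ^ t) e) \<subseteq> cyc_coset n (q ^ s) \<gamma>"
    using cyc_coset_power_subset[OF n assms(3)] cyc_coset_eq[OF ns] by blast
  show "cyc_coset n (q ^ s) \<gamma> \<subseteq> (\<Union>e\<in>cyc_coset n (q ^ s) \<gamma>. cyc_coset n (q ^ t) e)"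
  proof
    fix e assume e: "e \<in> cyc_coset n (q ^ s) \<gamma>"
    then have "e mod n = e" using cyc_coset_subset[OF n(1), of "q ^ s" \<gamma>] by auto
    then have "e \<in> cyc_coset n (q ^ t) e"
      using mod_in_cyc_coset[OF n(1) coprime_powerI[OF n(2), of t], of e] by simp
    then show "e \<in> (\<Union>e\<in>cyc_coset n (q ^ s) \<gamma>. cyc_coset n (q ^ t) e)" using e by blast
  qed
qed

lemma disjoint_cyc_cosets:
  assumes n: "n > 0" "coprime n N"
  shows "disjoint (cyc_coset n N ` A)"
proof -
  have "cyc_coset n N a = cyc_coset n N b" if "x \<in> cyc_coset n N a" "x \<in> cyc_coset n N b" for a b x
    using cyc_coset_eq[OF n that(1)] cyc_coset_eq[OF n that(2)] by simp
  then show ?thesis unfolding disjoint_def by blast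
qed

lemma partition_on_cyc_decomp:
  assumes n: "n > 0" "coprime n q" and t: "t > 0"
  shows "partition_on (cyc_coset n q \<gamma>) (cyc_decomp n q t \<gamma>)"
  unfolding partition_on_def cyc_decomp_eq_image[OF assms]
proof (intro conjI)
  show "\<Union> (cyc_coset n (q ^ t) ` cyc_coset n q \<gamma>) = cyc_coset n q \<gamma>"
    using Union_cyc_coset[OF n, of 1 t \<gamma>] by simp
  show "disjoint (cyc_coset n (q ^ t) ` cyc_coset n q \<gamma>)"
    by (rule disjoint_cyc_cosets[OF n(1) coprime_powerI[OF n(2)]])
  show "{} \<notin> cyc_coset n (q ^ t) ` cyc_coset n q \<gamma>"
    using mod_in_cyc_coset[OF n(1) coprime_powerI[OF n(2), of t]] by blast
qed

text \<open>The witness collects, for each block \<open>E\<close>, the \<open>q ^ t2\<close>-cosets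
  of its elements; because \<open>t1 dvd t2\<close> they stay inside \<open>E\<close>.\<close>

lemma finer_cyc_decomp_if_dvd:
  assumes n: "n > 0" "coprime n q" and t: "t2 > 0" and "t1 dvd t2"
  shows "finer (cyc_decomp n q t2 \<gamma>) (cyc_decomp n q t1 \<gamma>)"
proof -
  have t1: "t1 > 0" using assms by (auto intro: Nat.gr0I)
  define P where "P = cyc_decomp n q t1 \<gamma>"
  define J where "J E = cyc_coset n (q ^ t2) ` E" for E
  have P: "partition_on (cyc_coset n q \<gamma>) P"
    unfolding P_def by (rule partition_on_cyc_decomp[OF n t1])
  note n2 = n(1) coprime_powerI[OF n(2), of t2]
  have U: "\<Union> (J E) = E" if "E \<in> P" for E
    using that Union_cyc_coset[OF n assms(4)]
    by (auto simp: P_def cyc_decomp_eq_image[OF n t1] J_def)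
  have "cyc_decomp n q t2 \<gamma> = (\<Union>E\<in>P. J E)"
    using P by (auto simp: partition_on_def J_def cyc_decomp_eq_image[OF n t])
  moreover have "disjoint_family_on J P"
    unfolding disjoint_family_on_def
  proof (intro ballI impI)
    fix E F assume EF: "E \<in> P" "F \<in> P" "E \<noteq> F"
    have "E \<inter> F = {}" using P EF by (auto simp: partition_on_def disjoint_def)
    \<comment> \<open>A member common to \<open>J E\<close> and \<open>J F\<close> would lie in the
      empty set \<open>E \<inter> F\<close>, so nonemptiness is what excludes it.\<close>
    moreover have "B \<noteq> {}" if "B \<in> J E" for B
      using that mod_in_cyc_coset[OF n2] by (auto simp: J_def)
    ultimately show "J E \<inter> J F = {}" using U[OF EF(1)] U[OF EF(2)] by blast
  qed
  moreover have "disjoint (J E)" for E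
    unfolding J_def by (rule disjoint_cyc_cosets[OF n2])
  ultimately show ?thesis unfolding finer_def P_def[symmetric] using U
    by (intro exI[of _ J]) auto
qed

text \<open>The finer block of \<open>\<gamma>\<close> contains \<open>\<gamma> * q ^ t2\<close>,
  which therefore lies in the \<open>q ^ t1\<close>-coset of \<open>\<gamma>\<close>. Exponents may
  be compared modulo the period, hence modulo its divisor \<open>t1\<close>.\<close>

lemma dvd_if_finer_cyc_decomp:
  assumes n: "n > 0" "coprime n q" and t: "t1 > 0" "t2 > 0"
    and dvd: "t1 dvd ord (n div gcd \<gamma> n) q"
    and "finer (cyc_decomp n q t2 \<gamma>) (cyc_decomp n q t1 \<gamma>)"
  shows "t1 dvd t2"
proof -
  define e where "e = \<gamma> mod n"
  note n1 = n(1) coprime_powerI[OF n(2), of t1] and n2 = n(1) coprime_powerI[OF n(2), of t2]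
  obtain J where J: "cyc_decomp n q t2 \<gamma> = (\<Union>E\<in>cyc_decomp n q t1 \<gamma>. J E)"
    "\<And>E. E \<in> cyc_decomp n q t1 \<gamma> \<Longrightarrow> \<Union> (J E) = E"
    using assms(6) unfolding finer_def by metis
  define E where "E = cyc_coset n (q ^ t1) e"
  have E: "E \<in> cyc_decomp n q t1 \<gamma>"
    unfolding E_def e_def cyc_decomp_eq_image[OF n t(1)] using mod_in_cyc_coset[OF n] by blast
  have "e \<in> E" using mod_in_cyc_coset[OF n1, of \<gamma>] by (simp add: E_def e_def cyc_coset_mod[OF n1])
  then obtain B where B: "B \<in> J E" "e \<in> B" "B \<subseteq> E" using J(2)[OF E] by blast
  have "B \<in> cyc_decomp n q t2 \<gamma>" using B(1) E J(1) by blast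
  then have "B = cyc_coset n (q ^ t2) e"
    using cyc_coset_eq[OF n2] B(2) by (auto simp: cyc_decomp_eq_image[OF n t(2)])
  moreover have "\<gamma> * q ^ t2 mod n \<in> cyc_coset n (q ^ t2) e"
    unfolding e_def cyc_coset_mod[OF n2] cyc_coset_eq_range[OF n2] by (rule range_eqI[of _ _ 1]) (simp add: mod_mult_left_eq)
  ultimately have "\<gamma> * q ^ t2 mod n \<in> E" using B(3) by blast
  then obtain j where "\<gamma> * q ^ t2 mod n = \<gamma> * q ^ (t1 * j) mod n"
    unfolding E_def e_def cyc_coset_mod[OF n1] cyc_coset_eq_range[OF n1]
    by (auto simp: power_mult mod_mult_left_eq)
  then have "[t2 = t1 * j] (mod ord (n div gcd \<gamma> n) q)"
    using mult_power_cong_iff[OF n] by (simp add: cong_def)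
  then have "[t2 = t1 * j] (mod t1)" using dvd by (rule cong_dvd_modulus_nat)
  then show ?thesis by (simp add: cong_dvd_iff)
qed

text \<open>The strongest condition occurs at the class of 1, whose reduced modulus is
  \<open>n\<close> itself; the others follow by \<open>omega_dvd_mono\<close>.\<close>

lemma all_omega_dvd_iff:
  assumes "n > 0" "coprime n q"
  shows "(\<forall>i<n. omega q (n div gcd i n) dvd t) \<longleftrightarrow> omega q n dvd t"
proof
  assume *: "\<forall>i<n. omega q (n div gcd i n) dvd t"
  \<comment> \<open>The index is \<open>1 mod n\<close> instead of 1 because for
    \<open>n = 1\<close> the only index is 0.\<close>
  have "gcd (1 mod n) n = 1" using assms(1) by (simp add: gcd_mod_left)
  then show "omega q n dvd t" using *[rule_format, of "1 mod n"] assms(1) by simp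
next
  assume *: "omega q n dvd t"
  show "\<forall>i<n. omega q (n div gcd i n) dvd t"
    using omega_dvd_mono[OF assms div_gcd_dvd *] by blast
qed

text \<open>All blocks share one reduced modulus, so they are equal-difference sets together or not
  at all.\<close>

lemma equal_difference_decomp_iff:
  assumes n: "n > 0" "coprime n q" "q > 0" and t: "t > 0"
  shows "equal_difference_decomp n (cyc_coset n q \<gamma>) (cyc_decomp n q t \<gamma>) \<longleftrightarrow>
    omega q (n div gcd \<gamma> n) dvd t"
proof -
  have "equal_difference n (cyc_coset n (q ^ t) e) \<longleftrightarrow> omega q (n div gcd \<gamma> n) dvd t"
    if "e \<in> cyc_coset n q \<gamma>" for e
    using equal_difference_cyc_coset_iff[OF n] gcd_cyc_coset[OF n(1,2) that] by simp
  then show ?thesis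
    using partition_on_cyc_decomp[OF n(1,2) t] mod_in_cyc_coset[OF n(1,2), of \<gamma>]
    unfolding equal_difference_decomp_def cyc_decomp_eq_image[OF n(1,2) t] by blast
qed

text \<open>Replacing \<open>t\<close> by \<open>gcd t \<tau>\<close> keeps the decomposition, and
  keeps divisibility by \<open>\<omega>\<close> because \<open>\<omega> dvd \<tau>\<close>.\<close>

lemma MER_eq:
  fixes n q \<gamma> :: nat
  assumes n: "n > 0" "coprime n q" "q > 0"
  defines "\<tau> \<equiv> ord (n div gcd \<gamma> n) q" and "\<omega> \<equiv> omega q (n div gcd \<gamma> n)"
  shows "MER n q \<gamma> = (\<lambda>t. cyc_decomp n q t \<gamma>) ` {t. t dvd \<tau> \<and> \<omega> dvd t}"
proof -
  have m: "n div gcd \<gamma> n > 0" "coprime (n div gcd \<gamma> n) q"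
    using n(1) coprime_div_gcd[OF n(2)] by (simp_all add: div_greater_zero_iff)
  have \<tau>: "\<tau> > 0" using m(2) by (simp add: \<tau>_def)
  have "\<omega> dvd \<tau>" unfolding \<omega>_def \<tau>_def using omega_dvd_ord[OF m] .
  have "MER n q \<gamma> = (\<lambda>t. cyc_decomp n q t \<gamma>) ` {t. t > 0 \<and> \<omega> dvd t}"
    using equal_difference_decomp_iff[OF n] by (auto simp: MER_def \<omega>_def Suc_le_eq)
  also have "\<dots> = (\<lambda>t. cyc_decomp n q t \<gamma>) ` {t. t dvd \<tau> \<and> \<omega> dvd t}"
  proof (intro equalityI subsetI)
    fix P assume "P \<in> (\<lambda>t. cyc_decomp n q t \<gamma>) ` {t. t > 0 \<and> \<omega> dvd t}"
    then obtain t where t: "t > 0" "\<omega> dvd t" "P = cyc_decomp n q t \<gamma>" by blast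
    then have "P = cyc_decomp n q (gcd t \<tau>) \<gamma>"
      using cyc_decomp_gcd[OF n(1,2) t(1)] by (simp add: \<tau>_def)
    then show "P \<in> (\<lambda>t. cyc_decomp n q t \<gamma>) ` {t. t dvd \<tau> \<and> \<omega> dvd t}"
      using t(2) \<open>\<omega> dvd \<tau>\<close> by (intro image_eqI[of _ _ "gcd t \<tau>"]) auto
  qed (use \<tau> in \<open>auto intro: Nat.gr0I\<close>)
  finally show ?thesis .
qed

lemma finer_cyc_decomp_iff:
  assumes n: "n > 0" "coprime n q"
    and t: "t1 dvd ord (n div gcd \<gamma> n) q" "t2 dvd ord (n div gcd \<gamma> n) q"
  shows "finer (cyc_decomp n q t2 \<gamma>) (cyc_decomp n q t1 \<gamma>) \<longleftrightarrow> t1 dvd t2"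
proof -
  have "ord (n div gcd \<gamma> n) q > 0" using coprime_div_gcd[OF n(2)] by simp
  then have "t1 > 0" "t2 > 0" using t by (blast intro: dvd_pos_nat)+
  then show ?thesis
    using finer_cyc_decomp_if_dvd[OF n] dvd_if_finer_cyc_decomp[OF n _ _ t(1)] by blast
qed

section \<open>Tuples of decompositions with a common parameter\<close>

text \<open>The image form avoids choosing representatives, and the restricted abstraction matches
  the extensional normalisation of tuples.\<close>

definition decomp_tuple :: "nat \<Rightarrow> nat \<Rightarrow> nat \<Rightarrow> nat set \<Rightarrow> nat set set" where
  "decomp_tuple n q t = (\<lambda>C\<in>cyc_cosets n q. cyc_coset n (q ^ t) ` C)"

lemma decomp_tuple_cyc_coset:
  assumes "n > 0" "coprime n q" "t > 0"
  shows "decomp_tuple n q t (cyc_coset n q \<gamma>) = cyc_decomp n q t \<gamma>"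
proof -
  have "cyc_coset n q \<gamma> = cyc_coset n q (\<gamma> mod n)" by (simp add: cyc_coset_mod[OF assms(1,2)])
  moreover have "cyc_coset n q (\<gamma> mod n) \<in> cyc_cosets n q"
    unfolding cyc_cosets_def using assms(1) by (intro imageI) simp
  ultimately show ?thesis by (simp add: decomp_tuple_def cyc_decomp_eq_image[OF assms])
qed

lemma is_cyc_decomp_tuple_iff:
  assumes "n > 0" "coprime n q" "t > 0"
  shows "is_cyc_decomp_tuple n q t D \<longleftrightarrow> D = decomp_tuple n q t"
proof
  assume D: "is_cyc_decomp_tuple n q t D"
  show "D = decomp_tuple n q t"
  proof (rule extensionalityI)
    show "D \<in> extensional (cyc_cosets n q)" using D by (simp add: is_cyc_decomp_tuple_def)
    show "decomp_tuple n q t \<in> extensional (cyc_cosets n q)" by (simp add: decomp_tuple_def)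
    show "D C = decomp_tuple n q t C" if "C \<in> cyc_cosets n q" for C
      using that D by (auto simp: cyc_cosets_def is_cyc_decomp_tuple_def decomp_tuple_cyc_coset[OF assms])
  qed
next
  assume "D = decomp_tuple n q t"
  then show "is_cyc_decomp_tuple n q t D"
    by (simp add: is_cyc_decomp_tuple_def decomp_tuple_cyc_coset[OF assms]) (simp add: decomp_tuple_def)
qed

text \<open>As \<open>ord n q\<close> is a multiple of every coset period, the single parameter
  \<open>gcd t (ord n q)\<close> works in all components. The conditions for all
  \<open>\<gamma>\<close> merge into \<open>omega q n dvd t\<close>.\<close>

lemma MER_all_eq:
  assumes n: "n > 0" "coprime n q" "q > 0"
  shows "MER_all n q = decomp_tuple n q ` {t. t dvd ord n q \<and> omega q n dvd t}"
proof -
  define \<tau> where "\<tau> = ord n q"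
  have \<tau>: "\<tau> > 0" using n(2) by (simp add: \<tau>_def)
  have "omega q n dvd \<tau>" unfolding \<tau>_def using omega_dvd_ord[OF n(1,2)] .
  have in_MER: "(\<forall>\<gamma><n. decomp_tuple n q t (cyc_coset n q \<gamma>) \<in> MER n q \<gamma>) \<longleftrightarrow> omega q n dvd t"
    if "t > 0" for t
  proof -
    have "cyc_decomp n q t \<gamma> \<in> MER n q \<gamma> \<longleftrightarrow> omega q (n div gcd \<gamma> n) dvd t" for \<gamma>
      using equal_difference_decomp_iff[OF n that] that by (auto simp: MER_def Suc_le_eq)
    then show ?thesis
      by (simp add: decomp_tuple_cyc_coset[OF n(1,2) that] all_omega_dvd_iff[OF n(1,2)])
  qed
  have "MER_all n q = decomp_tuple n q ` {t. t > 0 \<and> omega q n dvd t}"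
    unfolding MER_all_def using in_MER is_cyc_decomp_tuple_iff[OF n(1,2)]
    by (auto simp: Suc_le_eq)
  also have "\<dots> = decomp_tuple n q ` {t. t dvd \<tau> \<and> omega q n dvd t}"
  proof (intro equalityI subsetI)
    fix D assume "D \<in> decomp_tuple n q ` {t. t > 0 \<and> omega q n dvd t}"
    then obtain t where t: "t > 0" "omega q n dvd t" "D = decomp_tuple n q t" by blast
    have "is_cyc_decomp_tuple n q (gcd t \<tau>) D"
    proof -
      have "D (cyc_coset n q \<gamma>) = cyc_decomp n q (gcd t \<tau>) \<gamma>" for \<gamma>
        unfolding t(3) \<tau>_def decomp_tuple_cyc_coset[OF n(1,2) t(1)]
        by (rule cyc_decomp_gcd[OF n(1,2) t(1) ord_dvd_mono[OF div_gcd_dvd], symmetric])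
      moreover have "D \<in> extensional (cyc_cosets n q)" by (simp add: t(3) decomp_tuple_def)
      ultimately show ?thesis by (simp add: is_cyc_decomp_tuple_def)
    qed
    then have "D = decomp_tuple n q (gcd t \<tau>)" using t(1) is_cyc_decomp_tuple_iff[OF n(1,2)] by simp
    then show "D \<in> decomp_tuple n q ` {t. t dvd \<tau> \<and> omega q n dvd t}"
      using t(2) \<open>omega q n dvd \<tau>\<close> by (intro image_eqI[of _ _ "gcd t \<tau>"]) auto
  qed (use \<tau> in \<open>auto intro: Nat.gr0I\<close>)
  finally show ?thesis by (simp add: \<tau>_def)
qed

text \<open>The coset of 1 has period \<open>ord n q\<close>, so comparison at this one coset
  already yields the divisibility.\<close>

lemma tuple_finer_decomp_tuple_iff:
  assumes n: "n > 0" "coprime n q" and t: "t1 dvd ord n q" "t2 dvd ord n q"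
  shows "tuple_finer n q (decomp_tuple n q t2) (decomp_tuple n q t1) \<longleftrightarrow> t1 dvd t2"
proof -
  have "ord n q > 0" using n(2) by simp
  then have pos: "t1 > 0" "t2 > 0" using t by (blast intro: dvd_pos_nat)+
  have "tuple_finer n q (decomp_tuple n q t2) (decomp_tuple n q t1) \<longleftrightarrow>
    (\<forall>\<gamma><n. finer (cyc_decomp n q t2 \<gamma>) (cyc_decomp n q t1 \<gamma>))"
    unfolding tuple_finer_def
    by (auto simp: cyc_cosets_def decomp_tuple_cyc_coset[OF n] pos)
  also have "\<dots> \<longleftrightarrow> t1 dvd t2"
  proof
    assume *: "\<forall>\<gamma><n. finer (cyc_decomp n q t2 \<gamma>) (cyc_decomp n q t1 \<gamma>)"
    have "gcd (1 mod n) n = 1" using n(1) by (simp add: gcd_mod_left)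
    then show "t1 dvd t2"
      using *[rule_format, of "1 mod n"] n(1) dvd_if_finer_cyc_decomp[OF n pos, of "1 mod n"] t(1) by simp
  qed (use finer_cyc_decomp_if_dvd[OF n pos(2)] in blast)
  finally show ?thesis .
qed

section \<open>Irreducible binomials over finite fields\<close>

text \<open>Indexing by exponent sets treats the coset polynomial, \<open>X ^ n - 1\<close> and
  their irreducible factors over extension fields uniformly.\<close>

definition root_poly :: "'a :: field \<Rightarrow> nat set \<Rightarrow> 'a poly" where
  "root_poly z S = (\<Prod>i\<in>S. [:- (z ^ i), 1:])"

lemma poly_root_poly_eq_0_iff:
  assumes "finite S"
  shows "poly (root_poly z S) x = 0 \<longleftrightarrow> (\<exists>i\<in>S. x = z ^ i)"
  using assms by (auto simp: root_poly_def poly_prod)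

lemma lead_coeff_root_poly: "Polynomial.lead_coeff (root_poly z S) = 1"
  unfolding root_poly_def by (subst lead_coeff_prod) simp

lemma root_poly_nonzero: "root_poly z S \<noteq> 0"
  using lead_coeff_root_poly[of z S] by auto

lemma degree_root_poly: "Polynomial.degree (root_poly z S) = card S"
  unfolding root_poly_def by (subst Polynomial.degree_prod_eq_sum_degree) auto

lemma prod_linear_factors_dvd:
  fixes p :: "'a :: idom poly"
  assumes "finite A" and "\<And>a. a \<in> A \<Longrightarrow> poly p a = 0"
  shows "(\<Prod>a\<in>A. [:- a, 1:]) dvd p"
  using assms
proof (induction A rule: finite_induct)
  case (insert a A)
  then obtain h where h: "p = (\<Prod>a\<in>A. [:- a, 1:]) * h" by auto
  have "poly (\<Prod>a\<in>A. [:- a, 1:]) a \<noteq> 0" using insert.hyps by (auto simp: poly_prod)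
  then have "poly h a = 0" using insert.prems[of a] h by simp
  then have "[:- a, 1:] dvd h" by (simp add: poly_eq_0_iff_dvd)
  then have "[:- a, 1:] * (\<Prod>a\<in>A. [:- a, 1:]) dvd h * (\<Prod>a\<in>A. [:- a, 1:])"
    by (intro mult_dvd_mono dvd_refl)
  then show ?case unfolding h prod.insert[OF insert.hyps] by (simp only: mult.commute)
qed simp

lemma root_poly_dvd:
  assumes "finite S" "inj_on (\<lambda>i. z ^ i) S" and "\<And>i. i \<in> S \<Longrightarrow> poly p (z ^ i) = 0"
  shows "root_poly z S dvd p"
proof -
  have "root_poly z S = (\<Prod>a\<in>(\<lambda>i. z ^ i) ` S. [:- a, 1:])"
    unfolding root_poly_def by (simp add: prod.reindex[OF assms(2)])
  then show ?thesis using assms by (auto intro!: prod_linear_factors_dvd)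
qed

lemma monic_eq_if_dvd:
  fixes p r :: "'a :: idom poly"
  assumes "r dvd p" "Polynomial.lead_coeff r = 1" "Polynomial.lead_coeff p = 1"
    and "Polynomial.degree p = Polynomial.degree r"
  shows "p = r"
proof -
  obtain h where h: "p = r * h" using assms(1) by blast
  have "p \<noteq> 0" using assms(3) by auto
  then have "Polynomial.degree h = 0"
    using assms(4) h by (auto simp: Polynomial.degree_mult_eq)
  then obtain c where c: "h = [:c:]" by (rule degree_eq_zeroE)
  have "Polynomial.lead_coeff r * Polynomial.lead_coeff h = 1"
    using assms(3) unfolding h by (simp only: Polynomial.lead_coeff_mult)
  then have "h = 1" using assms(2) c by (simp add: one_pCons)
  then show ?thesis using h by simp
qed

lemma root_poly_eqI:
  assumes "finite S" "inj_on (\<lambda>i. z ^ i) S" and "\<And>i. i \<in> S \<Longrightarrow> poly p (z ^ i) = 0"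
    and "Polynomial.lead_coeff p = 1" "Polynomial.degree p = card S"
  shows "p = root_poly z S"
  by (rule monic_eq_if_dvd[OF root_poly_dvd[OF assms(1-3)] lead_coeff_root_poly assms(4)])
     (simp_all add: assms(5) degree_root_poly)

section \<open>Powers of a primitive root of unity and binomials\<close>

lemma primitive_root_power_eq_iff:
  fixes z :: "'a :: field"
  assumes z: "primitive_root_of_unity n z" and n: "n > 0"
  shows "z ^ i = z ^ j \<longleftrightarrow> [i = j] (mod n)"
proof -
  have zn: "z ^ n = 1" using z by (simp add: primitive_root_of_unity_def)
  have z0: "z \<noteq> 0" using zn n by (auto simp: power_0_left)
  have md: "z ^ i = z ^ (i mod n)" for i
  proof -
    have "z ^ i = z ^ (i div n * n + i mod n)" by simp
    also have "\<dots> = (z ^ n) ^ (i div n) * z ^ (i mod n)"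
      by (simp only: power_add power_mult[symmetric] mult.commute)
    finally show ?thesis by (simp add: zn)
  qed
  have less: False if "z ^ a = z ^ b" "a < b" "b < n" for a b
  proof -
    have "b = a + (b - a)" using that by simp
    then have "z ^ b = z ^ a * z ^ (b - a)" by (metis power_add)
    then have "z ^ (b - a) = 1" using that(1) z0 by simp
    then show False using z that by (auto simp: primitive_root_of_unity_def)
  qed
  show ?thesis
  proof
    assume "z ^ i = z ^ j"
    then have "z ^ (i mod n) = z ^ (j mod n)" using md by metis
    then show "[i = j] (mod n)"
      unfolding cong_def using less[of "i mod n" "j mod n"] less[of "j mod n" "i mod n"] n
      by (metis linorder_neqE_nat mod_less_divisor)
  next
    assume "[i = j] (mod n)"
    then show "z ^ i = z ^ j" using md by (metis cong_def)
  qed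
qed

lemma primitive_root_inj_on:
  assumes "primitive_root_of_unity n z" "n > 0" "S \<subseteq> {..<n}"
  shows "inj_on (\<lambda>i. z ^ i) S"
  using assms(3) by (auto intro!: inj_onI simp: primitive_root_power_eq_iff[OF assms(1,2)] cong_def subset_eq)

lemma degree_lead_coeff_binomial:
  fixes a :: "'a :: field"
  assumes "k > 0"
  shows "Polynomial.degree (Polynomial.monom 1 k + [:a:]) = k"
    and "Polynomial.lead_coeff (Polynomial.monom 1 k + [:a:]) = 1"
proof -
  show *: "Polynomial.degree (Polynomial.monom 1 k + [:a:]) = k"
    using assms by (subst Polynomial.degree_add_eq_left) (simp_all add: Polynomial.degree_monom_eq)
  show "Polynomial.lead_coeff (Polynomial.monom 1 k + [:a:]) = 1"
    unfolding * using assms by (cases k) simp_all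
qed

lemma monom_minus_one_eq_root_poly:
  assumes "primitive_root_of_unity n z" "n > 0"
  shows "Polynomial.monom 1 n - 1 = root_poly z {..<n}"
proof (rule root_poly_eqI)
  have *: "Polynomial.monom 1 n - 1 = Polynomial.monom 1 n + [:- 1 :: 'a:]"
    by (simp add: one_pCons)
  show "Polynomial.lead_coeff (Polynomial.monom (1 :: 'a) n - 1) = 1"
    unfolding * by (rule degree_lead_coeff_binomial(2)[OF assms(2)])
  show "Polynomial.degree (Polynomial.monom (1 :: 'a) n - 1) = card {..<n}"
    unfolding * degree_lead_coeff_binomial(1)[OF assms(2)] by simp
  show "poly (Polynomial.monom 1 n - 1) (z ^ i) = 0" for i
  proof -
    have "(z ^ i) ^ n = (z ^ n) ^ i" by (simp add: power_mult[symmetric] mult.commute)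
    then show ?thesis using assms(1) by (simp add: poly_monom primitive_root_of_unity_def)
  qed
qed (use primitive_root_inj_on[OF assms] in auto)

text \<open>On a residue class modulo \<open>n div k\<close> all \<open>z ^ i\<close> have the same
  \<open>k\<close>-th power, so a binomial of degree \<open>k\<close> vanishes at all of them.
  Conversely, roots of a binomial share their \<open>k\<close>-th power, which confines
  \<open>E\<close> to a residue class that counting shows to be equal to it.\<close>

lemma is_binomial_root_poly_iff:
  fixes z :: "'a :: field"
  assumes z: "primitive_root_of_unity n z" and n: "n > 0" and E: "E \<subseteq> {..<n}" "E \<noteq> {}"
  shows "is_binomial (root_poly z E) \<longleftrightarrow> equal_difference n E"
proof -
  obtain e where e: "e \<in> E" using E by blast
  have fin: "finite E" using E(1) finite_subset by blast
  define k where "k = card E"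
  have k: "k > 0" using e fin by (auto simp: k_def card_gt_0_iff)
  note inj = primitive_root_inj_on[OF z n E(1)]
  show ?thesis
  proof
    assume "equal_difference n E"
    then have ED: "k dvd n" "E = {x. x < n \<and> [x = e] (mod (n div k))}"
      unfolding equal_difference_iff_residue_class[OF n e] k_def by auto
    have "Polynomial.monom 1 k + [:- (z ^ (e * k)):] = root_poly z E"
    proof (rule root_poly_eqI[OF fin inj])
      fix i assume "i \<in> E"
      then have "[i = e] (mod (n div k))" using ED(2) by blast
      then have "[i * k = e * k] (mod (n div k * k))" by (simp add: cong_def mult_mod_left[symmetric])
      then have "z ^ (i * k) = z ^ (e * k)"
        using ED(1) by (simp add: primitive_root_power_eq_iff[OF z n])
      then show "poly (Polynomial.monom 1 k + [:- (z ^ (e * k)):]) (z ^ i) = 0"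
        by (simp add: poly_monom power_mult[symmetric])
    qed (use degree_lead_coeff_binomial[OF k] in \<open>simp_all only: k_def\<close>)
    then show "is_binomial (root_poly z E)" using k unfolding is_binomial_def by metis
  next
    assume "is_binomial (root_poly z E)"
    then obtain k' a where "k' > 0" and eq: "root_poly z E = Polynomial.monom 1 k' + [:a:]"
      unfolding is_binomial_def by blast
    then have [simp]: "k' = k"
      using degree_root_poly[of z E] degree_lead_coeff_binomial(1)[of k' a] by (simp add: k_def)
    \<comment> \<open>At this point \<open>k dvd n\<close> is open, so equal \<open>k\<close>-th
      powers give a congruence only modulo \<open>n div gcd k n\<close>. That class has
      \<open>g\<close> elements and contains the \<open>k\<close> elements of \<open>E\<close>,
      which forces \<open>g = k\<close>.\<close>
    define g where "g = gcd k n"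
    have g: "g > 0" "g dvd n" using n by (simp_all add: g_def)
    have sub: "E \<subseteq> {x. x < n \<and> [x = e] (mod (n div g))}"
    proof
      fix x assume x: "x \<in> E"
      have "z ^ (i * k) = - a" if "i \<in> E" for i
      proof -
        have "poly (root_poly z E) (z ^ i) = 0" using that poly_root_poly_eq_0_iff[OF fin] by blast
        then show ?thesis unfolding eq by (simp add: poly_monom power_mult eq_neg_iff_add_eq_0)
      qed
      then have "z ^ (x * k) = z ^ (e * k)" using x e by simp
      then have "[k * x = k * e] (mod n)"
        by (simp add: primitive_root_power_eq_iff[OF z n] mult.commute)
      then show "x \<in> {x. x < n \<and> [x = e] (mod (n div g))}"
        using x E(1) by (auto simp: mult_cong_mult_iff[OF n] g_def)
    qed
    have card: "card {x. x < n \<and> [x = e] (mod (n div g))} = g"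
    proof -
      obtain r where r: "n = g * r" using g(2) by blast
      then have "r > 0" "n div g = r" "n div r = g" "r dvd n" using n g(1) by auto
      then show ?thesis using card_residue_class[OF n, of r e] by simp
    qed
    have "k \<le> g" using card_mono[OF _ sub] card by (simp add: k_def)
    moreover have "g \<le> k" using k by (simp add: g_def)
    ultimately have "g = k" by simp
    then have "E = {x. x < n \<and> [x = e] (mod (n div k))}"
      using sub card by (intro card_subset_eq) (auto simp: k_def)
    moreover have "k dvd n" using g(2) \<open>g = k\<close> by simp
    ultimately show "equal_difference n E"
      unfolding equal_difference_iff_residue_class[OF n e] k_def by simp
  qed
qed


lemma coset_poly_eq_root_poly:
  assumes z: "primitive_root_of_unity n (\<zeta> n)" and n: "n > 0" "coprime n q"
  shows "coset_poly \<zeta> n q \<gamma> = root_poly (\<zeta> n) (cyc_coset n q \<gamma>)"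
proof -
  note inj = card_cyc_coset(2)[OF n, of \<gamma>]
  have C: "cyc_coset n q \<gamma> = (\<lambda>j. \<gamma> * q ^ j mod n) ` {..<ord (n div gcd \<gamma> n) q}"
    by (simp add: cyc_coset_def coset_period_eq_ord[OF n])
  have "\<zeta> n ^ (\<gamma> * q ^ j) = \<zeta> n ^ (\<gamma> * q ^ j mod n)" for j
    by (simp add: primitive_root_power_eq_iff[OF z n(1)])
  then show ?thesis
    unfolding coset_poly_def root_poly_def card_cyc_coset(1)[OF n] unfolding C prod.reindex[OF inj] o_def
    by presburger
qed

section \<open>Irreducible polynomials over the fixed field of the Frobenius map
  \<open>x ^ Q\<close>\<close>

context
  fixes z :: "'a :: field" and n Q k :: nat and K :: "'a set"
  assumes char: "prime CHAR('a)" "Q = CHAR('a) ^ k"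
    and z: "primitive_root_of_unity n z" and n: "n > 0" "coprime n Q"
  defines "K \<equiv> {x. x ^ Q = x}"
begin

lemma Q_pos: "Q > 0"
  using char prime_gt_0_nat by simp

lemma power_Q_diff: "(x - y :: 'a) ^ Q = x ^ Q - y ^ Q"
  using freshmans_dream'[OF char, of "x - y" y] by (simp add: algebra_simps)

text \<open>Since \<open>K\<close> consists of the fixed points of Frobenius, having coefficients in
  \<open>K\<close> becomes an equation that behaves well under products.\<close>

lemma polys_over_iff_Frobenius: "p \<in> polys_over K \<longleftrightarrow> map_poly (\<lambda>x. x ^ Q) p = p"
  using Q_pos by (auto simp: polys_over_def K_def poly_eq_iff coeff_map_poly)

lemma Frobenius_mult:
  "map_poly (\<lambda>x. x ^ Q) (p * r) = map_poly (\<lambda>x. x ^ Q) p * map_poly (\<lambda>x :: 'a. x ^ Q) r"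
  using Q_pos
  by (auto simp: poly_eq_iff coeff_map_poly coeff_mult freshmans_dream_sum'[OF char] power_mult_distrib)

lemma Frobenius_root_poly:
  "map_poly (\<lambda>x. x ^ Q) (root_poly z S) = (\<Prod>i\<in>S. [:- (z ^ (i * Q)), 1:])"
proof (induction S rule: infinite_finite_induct)
  case (insert i S)
  have "map_poly (\<lambda>x. x ^ Q) [:- (z ^ i), 1:] = [:- (z ^ (i * Q)), 1:]"
    using power_Q_diff[of 0 "z ^ i"] Q_pos by (simp add: map_poly_pCons power_mult power_0_left)
  then show ?case
    using insert.IH unfolding root_poly_def prod.insert[OF insert.hyps] Frobenius_mult by simp
qed (use Q_pos in \<open>simp_all add: root_poly_def one_pCons map_poly_pCons\<close>)

text \<open>Multiplication by \<open>Q\<close> permutes the coset, so Frobenius permutes the roots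
  and fixes the polynomial.\<close>

lemma root_poly_cyc_coset_in_polys_over:
  "root_poly z (cyc_coset n Q i) \<in> polys_over K"
proof -
  let ?B = "cyc_coset n Q i" and ?f = "\<lambda>i. i * Q mod n"
  have fin: "finite ?B" using cyc_coset_subset[OF n(1)] finite_subset by blast
  have "?f ` ?B \<subseteq> ?B"
  proof
    fix x assume "x \<in> ?f ` ?B"
    then obtain j where "x = i * Q ^ j mod n * Q mod n" by (auto simp: cyc_coset_eq_range[OF n])
    then have "x = i * Q ^ Suc j mod n" by (simp add: mod_mult_right_eq ac_simps)
    then show "x \<in> ?B" unfolding cyc_coset_eq_range[OF n] by (rule range_eqI)
  qed
  moreover have inj: "inj_on ?f ?B"
  proof (rule inj_onI)
    fix a b assume ab: "a \<in> ?B" "b \<in> ?B" "?f a = ?f b"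
    then have "[a = b] (mod n)"
      using cong_mult_rcancel_nat[of Q n a b] n(2) by (simp add: cong_def coprime_commute)
    moreover have "a < n" "b < n" using ab cyc_coset_subset[OF n(1)] by blast+
    ultimately show "a = b" by (simp add: cong_def)
  qed
  ultimately have "?f ` ?B = ?B" using fin by (simp add: endo_inj_surj)
  have "root_poly z ?B = (\<Prod>i\<in>?f ` ?B. [:- (z ^ i), 1:])"
    unfolding root_poly_def \<open>?f ` ?B = ?B\<close> ..
  also have "\<dots> = (\<Prod>i\<in>?B. [:- (z ^ (i * Q mod n)), 1:])"
    by (simp only: prod.reindex[OF inj] o_def)
  also have "\<dots> = (\<Prod>i\<in>?B. [:- (z ^ (i * Q)), 1:])"
  proof -
    have "z ^ (i * Q mod n) = z ^ (i * Q)" for i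
      by (simp add: primitive_root_power_eq_iff[OF z n(1)])
    then show ?thesis by (simp only:)
  qed
  finally show ?thesis
    unfolding polys_over_iff_Frobenius Frobenius_root_poly by (rule sym)
qed

lemma poly_power_Q_eq_0:
  assumes "p \<in> polys_over K" "poly p x = 0"
  shows "poly p (x ^ Q) = 0"
proof -
  have "poly p (x ^ Q) = (\<Sum>i\<le>Polynomial.degree p. (Polynomial.coeff p i * x ^ i) ^ Q)"
    unfolding poly_altdef using assms(1)
    by (intro sum.cong refl) (simp add: polys_over_def K_def power_mult_distrib power_mult[symmetric] mult.commute)
  also have "\<dots> = poly p x ^ Q"
    unfolding poly_altdef by (rule freshmans_dream_sum'[OF char, symmetric])
  finally show ?thesis using assms(2) Q_pos by simp
qed

text \<open>The roots of a polynomial over \<open>K\<close> are closed under \<open>Q\<close>-th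
  powers, so one root brings along its whole orbit. In effect the coset polynomial is the minimal
  polynomial of \<open>z ^ i\<close> over \<open>K\<close>.\<close>

lemma root_poly_cyc_coset_dvd:
  assumes "p \<in> polys_over K" "poly p (z ^ i) = 0"
  shows "root_poly z (cyc_coset n Q i) dvd p"
proof (rule root_poly_dvd)
  show "finite (cyc_coset n Q i)" using cyc_coset_subset[OF n(1)] finite_subset by blast
  show "inj_on (\<lambda>i. z ^ i) (cyc_coset n Q i)"
    by (rule primitive_root_inj_on[OF z n(1) cyc_coset_subset[OF n(1)]])
  have "poly p (z ^ (i * Q ^ j)) = 0" for j
  proof (induction j)
    case (Suc j)
    then show ?case
      using poly_power_Q_eq_0[OF assms(1) Suc] by (simp add: power_mult[symmetric] ac_simps)
  qed (use assms in simp)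
  moreover have "z ^ (i * Q ^ j mod n) = z ^ (i * Q ^ j)" for j
    by (simp add: primitive_root_power_eq_iff[OF z n(1)])
  ultimately show "poly p (z ^ l) = 0" if "l \<in> cyc_coset n Q i" for l
    using that by (auto simp: cyc_coset_eq_range[OF n])
qed

lemma poly_root_poly_cyc_coset: "poly (root_poly z (cyc_coset n Q i)) (z ^ i) = 0"
proof -
  have "finite (cyc_coset n Q i)" using cyc_coset_subset[OF n(1)] finite_subset by blast
  moreover have "z ^ i = z ^ (i mod n)" by (simp add: primitive_root_power_eq_iff[OF z n(1)])
  ultimately show ?thesis
    using mod_in_cyc_coset[OF n, of i] poly_root_poly_eq_0_iff by blast
qed

lemma card_cyc_coset_pos: "card (cyc_coset n Q i) > 0"
  using mod_in_cyc_coset[OF n, of i] finite_subset[OF cyc_coset_subset[OF n(1)]]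
  by (auto simp: card_gt_0_iff)

text \<open>In any factorization one factor vanishes at \<open>z ^ i\<close>, hence is divisible by
  the whole polynomial, which leaves degree 0 for the other.\<close>

lemma irreducible_over_root_poly_cyc_coset:
  "irreducible_over K (root_poly z (cyc_coset n Q i))"
  unfolding irreducible_over_def
proof (intro conjI ballI impI)
  let ?R = "root_poly z (cyc_coset n Q i)"
  show "?R \<in> polys_over K" by (rule root_poly_cyc_coset_in_polys_over)
  show "Polynomial.degree ?R > 0" by (simp add: degree_root_poly card_cyc_coset_pos)
  fix g h assume gh: "g \<in> polys_over K" "h \<in> polys_over K" "?R = g * h"
  then have nz: "g \<noteq> 0" "h \<noteq> 0" using root_poly_nonzero[of z "cyc_coset n Q i"] by auto
  then have deg: "Polynomial.degree ?R = Polynomial.degree g + Polynomial.degree h"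
    unfolding gh(3) by (rule Polynomial.degree_mult_eq)
  have "poly g (z ^ i) = 0 \<or> poly h (z ^ i) = 0"
    using poly_root_poly_cyc_coset[of i] unfolding gh(3) by simp
  then have "?R dvd g \<or> ?R dvd h" using gh root_poly_cyc_coset_dvd by blast
  then have "Polynomial.degree ?R \<le> Polynomial.degree g \<or> Polynomial.degree ?R \<le> Polynomial.degree h"
    using nz dvd_imp_degree_le by blast
  then show "Polynomial.degree g = 0 \<or> Polynomial.degree h = 0"
    using deg by linarith
qed

text \<open>
  The cofactor \<open>h\<close> has coefficients in \<open>K\<close> because Frobenius fixes both \<open>f\<close> and the coset polynomial.
\<close>

lemma irreducible_over_eq_root_poly:
  assumes f: "irreducible_over K f" "Polynomial.lead_coeff f = 1" and root: "poly f (z ^ i) = 0"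
  shows "f = root_poly z (cyc_coset n Q i)"
proof -
  let ?R = "root_poly z (cyc_coset n Q i)"
  have fK: "f \<in> polys_over K" using f(1) by (simp add: irreducible_over_def)
  then obtain h where h: "f = ?R * h" using root_poly_cyc_coset_dvd[OF _ root] by blast
  have "?R * map_poly (\<lambda>x. x ^ Q) h = ?R * h"
    using fK root_poly_cyc_coset_in_polys_over[of i] Frobenius_mult[of ?R h]
    unfolding polys_over_iff_Frobenius h by simp
  then have "h \<in> polys_over K" using root_poly_nonzero[of z "cyc_coset n Q i"] by (simp add: polys_over_iff_Frobenius)
  then have "Polynomial.degree ?R = 0 \<or> Polynomial.degree h = 0"
    using f(1) root_poly_cyc_coset_in_polys_over[of i] h unfolding irreducible_over_def by metis
  then have "Polynomial.degree h = 0" using card_cyc_coset_pos[of i] by (simp add: degree_root_poly)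
  moreover have "h \<noteq> 0" using f(2) h by auto
  ultimately have "Polynomial.degree f = Polynomial.degree ?R"
    unfolding h by (subst Polynomial.degree_mult_eq) (auto simp: root_poly_nonzero)
  then show ?thesis
    using h f(2) by (intro monic_eq_if_dvd) (auto simp: lead_coeff_root_poly)
qed

text \<open>Monic irreducible factors over \<open>K\<close> with a root \<open>z ^ i\<close> are
  coset polynomials, so the factorization leaves no choice; each coset polynomial is then tested by
  \<open>is_binomial_root_poly_iff\<close>.\<close>

lemma factors_into_irreducible_binomials_iff:
  assumes S: "S \<subseteq> {..<n}" and closed: "\<And>i. i \<in> S \<Longrightarrow> cyc_coset n Q i \<subseteq> S"
  shows "factors_into_irreducible_binomials K (root_poly z S) \<longleftrightarrow>
    (\<forall>i\<in>S. equal_difference n (cyc_coset n Q i))"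
proof -
  have fin: "finite S" using S finite_subset by blast
  have bin: "is_binomial (root_poly z (cyc_coset n Q i)) \<longleftrightarrow> equal_difference n (cyc_coset n Q i)" for i
    using mod_in_cyc_coset[OF n, of i]
    by (intro is_binomial_root_poly_iff[OF z n(1) cyc_coset_subset[OF n(1)]]) blast
  show ?thesis
  proof
    assume "factors_into_irreducible_binomials K (root_poly z S)"
    then obtain F where F: "root_poly z S = prod_mset F"
      "\<And>f. f \<in># F \<Longrightarrow> irreducible_over K f \<and> is_binomial f"
      unfolding factors_into_irreducible_binomials_def by blast
    show "\<forall>i\<in>S. equal_difference n (cyc_coset n Q i)"
    proof
      fix i assume "i \<in> S"
      then have "poly (root_poly z S) (z ^ i) = 0" using poly_root_poly_eq_0_iff[OF fin] by blast
      then have "0 \<in># image_mset (\<lambda>f. poly f (z ^ i)) F"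
        unfolding F(1) using poly_prod_mset[of "\<lambda>f. f" F "z ^ i"] by (simp add: prod_mset_zero_iff)
      then obtain f where f: "f \<in># F" "poly f (z ^ i) = 0" by auto
      \<comment> \<open>Binomials are monic by definition, which singles out the factor among its
        scalar multiples.\<close>
      have "Polynomial.lead_coeff f = 1"
        using F(2)[OF f(1)] degree_lead_coeff_binomial(2) unfolding is_binomial_def by blast
      then have "f = root_poly z (cyc_coset n Q i)"
        using F(2)[OF f(1)] f(2) by (intro irreducible_over_eq_root_poly) auto
      then show "equal_difference n (cyc_coset n Q i)" using F(2)[OF f(1)] bin by blast
    qed
  next
    assume ed: "\<forall>i\<in>S. equal_difference n (cyc_coset n Q i)"
    define P where "P = cyc_coset n Q ` S"
    have "S \<subseteq> \<Union> P"
    proof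
      fix i assume "i \<in> S"
      then have "i mod n = i" using S by auto
      then show "i \<in> \<Union> P" using mod_in_cyc_coset[OF n, of i] \<open>i \<in> S\<close> by (auto simp: P_def)
    qed
    then have U: "\<Union> P = S" using closed by (auto simp: P_def)
    have "A = B" if AB: "A \<in> P" "B \<in> P" "x \<in> A" "x \<in> B" for A B x
    proof -
      obtain a b where "A = cyc_coset n Q a" "B = cyc_coset n Q b" using AB by (auto simp: P_def)
      then show ?thesis using AB(3,4) cyc_coset_eq[OF n, of x a] cyc_coset_eq[OF n, of x b] by simp
    qed
    then have disj: "\<forall>A\<in>P. \<forall>B\<in>P. A \<noteq> B \<longrightarrow> A \<inter> B = {}" by blast
    have finP: "\<forall>A\<in>P. finite A"
      using finite_subset[OF cyc_coset_subset[OF n(1)]] by (auto simp: P_def)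
    \<comment> \<open>The cosets partition \<open>S\<close>, so the product over \<open>S\<close>
      can be grouped by cosets.\<close>
    have "root_poly z S = (\<Prod>B\<in>P. root_poly z B)"
      using prod.Union_disjoint[OF finP disj, of "\<lambda>i. [:- (z ^ i), 1:]"]
      by (simp add: U root_poly_def o_def)
    also have "\<dots> = prod_mset (image_mset (root_poly z) (mset_set P))"
      by (rule prod_unfold_prod_mset)
    finally show "factors_into_irreducible_binomials K (root_poly z S)"
      unfolding factors_into_irreducible_binomials_def
      using fin ed bin irreducible_over_root_poly_cyc_coset
      by (intro exI[of _ "image_mset (root_poly z) (mset_set P)"]) (auto simp: P_def)
  qed
qed

end

text \<open>
  A largest \<open>F\<close>-subspace of \<open>K\<close> among those whose cardinality is a power of \<open>card F\<close> is all of \<open>K\<close>: any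
  \<open>x\<close> outside \<open>W\<close> would give the larger subspace \<open>W + F x\<close>.
\<close>

lemma card_subfield_power:
  fixes F K :: "'a :: field set"
  assumes F: "is_subfield F" and K: "is_subfield K" and "finite K" and "F \<subseteq> K"
  shows "\<exists>t. card K = card F ^ t"
proof -
  define V where "V t W \<longleftrightarrow> W \<subseteq> K \<and> 0 \<in> W \<and> (\<forall>x\<in>W. \<forall>y\<in>W. x + y \<in> W) \<and>
    (\<forall>c\<in>F. \<forall>x\<in>W. c * x \<in> W) \<and> card W = card F ^ t" for t W
  have zero: "0 \<in> L" if "is_subfield L" for L :: "'a set"
    using that unfolding is_subfield_iff by (metis add.right_inverse)
  have minus: "x - y \<in> L" if "is_subfield L" "x \<in> L" "y \<in> L" for L :: "'a set" and x y
    using that unfolding is_subfield_iff by (metis add_uminus_conv_diff)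
  have finF: "finite F" using assms finite_subset by blast
  have "card {0, 1 :: 'a} \<le> card F"
    using zero[OF F] F finF by (intro card_mono) (auto simp: is_subfield_iff)
  then have F2: "card F \<ge> 2" by simp
  have "V 0 {0}" using zero[OF K] by (simp add: V_def)
  \<comment> \<open>The bound guarantees a greatest exponent: \<open>t < 2 ^ t\<close>, and
    \<open>2 ^ t\<close> is at most \<open>card F ^ t\<close>, which is at most
    \<open>card K\<close>.\<close>
  moreover have "\<forall>t. (\<exists>W. V t W) \<longrightarrow> t < card K"
  proof (intro allI impI)
    fix t assume "\<exists>W. V t W"
    then obtain W where "W \<subseteq> K" "card W = card F ^ t" by (auto simp: V_def)
    then have "card F ^ t \<le> card K" using card_mono[OF \<open>finite K\<close>] by metis
    moreover have "t < 2 ^ t" by (rule less_exp)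
    moreover have "(2::nat) ^ t \<le> card F ^ t" using F2 by (rule power_mono) simp
    ultimately show "t < card K" by linarith
  qed
  ultimately obtain t where t: "\<exists>W. V t W" "\<And>s. \<exists>W. V s W \<Longrightarrow> s \<le> t"
    using ex_has_greatest_nat[of "\<lambda>t. \<exists>W. V t W" 0 "\<lambda>t. t" "card K"] by blast
  then obtain W where W: "V t W" by blast
  have "W = K"
  proof (rule ccontr)
    assume "W \<noteq> K"
    then obtain x where x: "x \<in> K" "x \<notin> W" using W by (auto simp: V_def)
    define W' where "W' = (\<lambda>(v, c). v + c * x) ` (W \<times> F)"
    have W'_iff: "a \<in> W' \<longleftrightarrow> (\<exists>v\<in>W. \<exists>c\<in>F. a = v + c * x)" for a
      by (auto simp: W'_def image_iff)
    have m1: "- 1 \<in> F" using F by (auto simp: is_subfield_iff)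
    have "inj_on (\<lambda>(v, c). v + c * x) (W \<times> F)"
    proof (rule inj_onI, clarify)
      fix v c v' c' assume *: "v \<in> W" "c \<in> F" "v' \<in> W" "c' \<in> F" "v + c * x = v' + c' * x"
      have "c = c'"
      proof (rule ccontr)
        assume "c \<noteq> c'"
        \<comment> \<open>The form \<open>(- 1) * v\<close> replaces a subtraction because
          \<open>V\<close> provides only sums and scalar multiples.\<close>
        have "(c - c') * x = v' + (- 1) * v" using *(5) by (simp add: algebra_simps)
        then have "x = inverse (c - c') * (v' + (- 1) * v)"
          using \<open>c \<noteq> c'\<close> by (simp add: field_simps)
        moreover have "inverse (c - c') \<in> F" using minus[OF F] * F by (simp add: is_subfield_iff)
        moreover have "v' + (- 1) * v \<in> W" using W * m1 unfolding V_def by blast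
        ultimately have "x \<in> W" using W unfolding V_def by blast
        then show False using x(2) by blast
      qed
      then show "v = v' \<and> c = c'" using * by simp
    qed
    then have "card W' = card W * card F"
      unfolding W'_def by (simp add: card_image card_cartesian_product)
    then have "card W' = card F ^ Suc t" using W by (simp add: V_def)
    moreover have "W' \<subseteq> K"
      using W x(1) K \<open>F \<subseteq> K\<close> by (auto simp: W'_def V_def is_subfield_iff subset_eq)
    moreover have "0 \<in> W'"
      unfolding W'_def using W zero[OF F] by (intro image_eqI[of _ _ "(0, 0)"]) (auto simp: V_def)
    moreover have "a + b \<in> W'" if ab: "a \<in> W'" "b \<in> W'" for a b
    proof -
      obtain v c v' c' where *: "v \<in> W" "c \<in> F" "v' \<in> W" "c' \<in> F" "a = v + c * x" "b = v' + c' * x"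
        using ab W'_iff by blast
      moreover have "v + v' \<in> W" "c + c' \<in> F" using * W F by (auto simp: V_def is_subfield_iff)
      ultimately show ?thesis
        unfolding W'_def by (intro image_eqI[of _ _ "(v + v', c + c')"]) (auto simp: algebra_simps)
    qed
    moreover have "d * a \<in> W'" if da: "d \<in> F" "a \<in> W'" for a d
    proof -
      obtain v c where *: "v \<in> W" "c \<in> F" "a = v + c * x" using da W'_iff by blast
      moreover have "d * v \<in> W" "d * c \<in> F" using * da W F by (auto simp: V_def is_subfield_iff)
      ultimately show ?thesis
        unfolding W'_def by (intro image_eqI[of _ _ "(d * v, d * c)"]) (auto simp: algebra_simps)
    qed
    ultimately have "V (Suc t) W'" by (simp add: V_def)
    then show False using t(2)[of "Suc t"] by fastforce
  qed
  then show ?thesis using W unfolding V_def by blast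
qed

section \<open>The fields \<open>GF (q ^ t)\<close>, their inclusions and factorizations over
  them\<close>

context
  fixes q :: nat
  assumes q: "q = card (UNIV :: 'f :: finite_field set)"
begin

lemma q_ge_2: "q \<ge> 2"
proof -
  have "card {0, 1 :: 'f} \<le> q" unfolding q by (rule card_mono) auto
  then show ?thesis by simp
qed

lemma GF_power:
  assumes "t > 0"
  shows "(GF (q ^ t) :: 'f alg_closure set) = {x. x ^ (q ^ t) = x}"
    and "is_subfield (GF (q ^ t) :: 'f alg_closure set)"
    and "card (GF (q ^ t) :: 'f alg_closure set) = q ^ t"
    and "finite (GF (q ^ t) :: 'f alg_closure set)"
proof -
  have Q: "q ^ t = card (UNIV :: 'f set) ^ t" by (simp add: q)
  show "(GF (q ^ t) :: 'f alg_closure set) = {x. x ^ (q ^ t) = x}"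
    by (rule GF_eq[OF assms Q])
  from theI'[OF ex1_GF[OF assms Q]]
  show "is_subfield (GF (q ^ t) :: 'f alg_closure set)"
    and card: "card (GF (q ^ t) :: 'f alg_closure set) = q ^ t"
    unfolding GF_def by blast+
  show "finite (GF (q ^ t) :: 'f alg_closure set)"
    using card q_ge_2 by (intro card_ge_0_finite) simp
qed

text \<open>If \<open>a dvd b\<close>, iterate the Frobenius map. Conversely, by Bezout an element
  fixed by the powers \<open>q ^ a\<close> and \<open>q ^ b\<close> is fixed by
  \<open>q ^ gcd a b\<close>, and comparing cardinalities gives \<open>a = gcd a b\<close>.\<close>

lemma GF_subset_iff:
  assumes "a > 0" "b > 0"
  shows "(GF (q ^ a) :: 'f alg_closure set) \<subseteq> GF (q ^ b) \<longleftrightarrow> a dvd b"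
proof -
  have iter: "x ^ (q ^ (s * c)) = x" if "x ^ (q ^ s) = x" for x :: "'f alg_closure" and s c
  proof (induction c)
    case (Suc c)
    have "x ^ (q ^ (s * Suc c)) = (x ^ (q ^ s)) ^ (q ^ (s * c))"
      by (simp add: power_mult[symmetric] power_add)
    then show ?case using Suc that by simp
  qed simp
  show ?thesis
  proof
    assume "a dvd b"
    then obtain c where "b = a * c" by blast
    then show "(GF (q ^ a) :: 'f alg_closure set) \<subseteq> GF (q ^ b)"
      unfolding GF_power(1)[OF assms(1)] GF_power(1)[OF assms(2)] using iter[of _ a c] by blast
  next
    assume sub: "(GF (q ^ a) :: 'f alg_closure set) \<subseteq> GF (q ^ b)"
    define d where "d = gcd a b"
    have d: "d > 0" using assms by (simp add: d_def)
    obtain u v where uv: "a * u = b * v + d" using bezout_nat[of a b] assms unfolding d_def by blast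
    have "(GF (q ^ a) :: 'f alg_closure set) \<subseteq> GF (q ^ d)"
    proof
      fix x :: "'f alg_closure" assume x: "x \<in> GF (q ^ a)"
      then have "x ^ (q ^ a) = x" "x ^ (q ^ b) = x"
        using sub GF_power(1)[OF assms(1)] GF_power(1)[OF assms(2)] by blast+
      then have "x ^ (q ^ (a * u)) = x" "x ^ (q ^ (b * v)) = x" using iter by blast+
      moreover have "x ^ (q ^ (a * u)) = (x ^ (q ^ (b * v))) ^ (q ^ d)"
        unfolding uv by (simp add: power_mult[symmetric] power_add)
      ultimately have "x ^ (q ^ d) = x" by simp
      then show "x \<in> GF (q ^ d)" using GF_power(1)[OF d] by blast
    qed
    then have "q ^ a \<le> q ^ d"
      using card_mono[OF GF_power(4)[OF d]] GF_power(3)[OF assms(1)] GF_power(3)[OF d] by metis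
    then have "a \<le> d" using q_ge_2 by (simp add: power_increasing_iff)
    then have "d = a" using assms(1) by (metis d_def dvd_imp_le gcd_dvd1 le_antisym)
    then show "a dvd b" by (metis d_def gcd_dvd2)
  qed
qed

text \<open>An intermediate field has \<open>q ^ t\<close> elements for some \<open>t\<close> by
  \<open>card_subfield_power\<close>, and the subfield of that order is unique.\<close>

lemma extensions_within_GF:
  assumes "T > 0"
  shows "extensions_within (GF (q ^ T) :: 'f alg_closure set) = (\<lambda>t. GF (q ^ t)) ` {t. t dvd T}"
proof (intro equalityI subsetI)
  fix K :: "'f alg_closure set" assume "K \<in> (\<lambda>t. GF (q ^ t)) ` {t. t dvd T}"
  then obtain t where t: "t dvd T" "K = GF (q ^ t)" by blast
  have t0: "t > 0" using t assms by (auto intro: Nat.gr0I)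
  have "x ^ q = x" for x :: 'f
    using subfield_power_card[of "UNIV :: 'f set" x] by (simp add: is_subfield_iff q)
  then have x: "(to_ac x) ^ (q ^ t) = to_ac x" for x :: 'f
  proof (induction t)
    case (Suc t)
    have "(to_ac x) ^ (q ^ Suc t) = ((to_ac x) ^ q) ^ (q ^ t)" by (simp add: power_mult)
    also have "(to_ac x) ^ q = to_ac x" using Suc.prems by (metis to_ac_power)
    finally show ?case using Suc by simp
  qed simp
  then have "range to_ac \<subseteq> K" using GF_power(1)[OF t0] t(2) by auto
  then show "K \<in> extensions_within (GF (q ^ T))"
    using t GF_power(2)[OF t0] GF_subset_iff[OF t0 assms] by (simp add: extensions_within_def)
next
  fix K :: "'f alg_closure set" assume "K \<in> extensions_within (GF (q ^ T))"
  then have K: "is_subfield K" "range to_ac \<subseteq> K" "K \<subseteq> GF (q ^ T)"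
    by (auto simp: extensions_within_def)
  have finK: "finite K" using K(3) GF_power(4)[OF assms] finite_subset by blast
  have "is_subfield (range to_ac :: 'f alg_closure set)"
    unfolding is_subfield_iff
    by (auto simp flip: to_ac_1 to_ac_add to_ac_mult to_ac_minus to_ac_inverse)
  from card_subfield_power[OF this K(1) finK K(2)]
  obtain t where t: "card K = q ^ t" using card_image[OF inj_to_ac] by (metis q)
  have "q \<le> card K"
    using card_mono[OF finK K(2)] card_image[OF inj_to_ac] by (metis q)
  then have "t > 0" using t q_ge_2 by (cases t) auto
  then have "K = GF (q ^ t)"
    using ex1_GF[OF \<open>t > 0\<close>, of "q ^ t", where 'f = 'f] K(1) t GF_power(2,3)[OF \<open>t > 0\<close>] q by auto
  moreover have "t dvd T" using K(3) GF_subset_iff[OF \<open>t > 0\<close> assms] calculation by simp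
  ultimately show "K \<in> (\<lambda>t. GF (q ^ t)) ` {t. t dvd T}" by blast
qed

lemma GF_char:
  assumes "t > 0"
  shows "prime CHAR('f alg_closure)" "\<exists>k. q ^ t = CHAR('f alg_closure) ^ k"
proof -
  show "prime CHAR('f alg_closure)" by simp
  obtain k where "q = CHAR('f) ^ k" using card_finite_field_primepow[where 'f = 'f] q by blast
  then have "q ^ t = CHAR('f alg_closure) ^ (k * t)" by (simp add: power_mult)
  then show "\<exists>k. q ^ t = CHAR('f alg_closure) ^ k" ..
qed

text \<open>A set closed under \<open>q\<close>-cosets is closed under the smaller
  \<open>q ^ t\<close>-cosets, so the criterion over the fixed field applies with
  \<open>Q = q ^ t\<close>.\<close>

lemma root_poly_factors_GF_iff:
  fixes z :: "'f alg_closure"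
  assumes z: "primitive_root_of_unity n z" and n: "n > 0" "coprime n q" and t: "t > 0"
    and S: "S \<subseteq> {..<n}" "\<And>i. i \<in> S \<Longrightarrow> cyc_coset n q i \<subseteq> S"
  shows "factors_into_irreducible_binomials (GF (q ^ t)) (root_poly z S) \<longleftrightarrow>
    (\<forall>i\<in>S. omega q (n div gcd i n) dvd t)"
proof -
  obtain k where k: "q ^ t = CHAR('f alg_closure) ^ k" using GF_char(2)[OF t] by blast
  have "cyc_coset n (q ^ t) i \<subseteq> S" if "i \<in> S" for i
    using S(2)[OF that] cyc_coset_power_subset[OF n, of 1 t i] by simp
  then have "factors_into_irreducible_binomials (GF (q ^ t)) (root_poly z S) \<longleftrightarrow>
    (\<forall>i\<in>S. equal_difference n (cyc_coset n (q ^ t) i))"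
    unfolding GF_power(1)[OF t]
    using factors_into_irreducible_binomials_iff[OF GF_char(1)[OF t] k z n(1) coprime_powerI[OF n(2)] S(1)]
    by blast
  also have "\<dots> \<longleftrightarrow> (\<forall>i\<in>S. omega q (n div gcd i n) dvd t)"
    using equal_difference_cyc_coset_iff[OF n] q_ge_2 by simp
  finally show ?thesis .
qed

lemma coset_poly_factors_GF_iff:
  fixes \<zeta> :: "nat \<Rightarrow> 'f alg_closure"
  assumes z: "primitive_root_of_unity n (\<zeta> n)" and n: "n > 0" "coprime n q" and t: "t > 0"
  shows "factors_into_irreducible_binomials (GF (q ^ t)) (coset_poly \<zeta> n q \<gamma>) \<longleftrightarrow>
    omega q (n div gcd \<gamma> n) dvd t"
proof -
  have "cyc_coset n q i \<subseteq> cyc_coset n q \<gamma>" if "i \<in> cyc_coset n q \<gamma>" for i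
    using cyc_coset_eq[OF n that] by simp
  from root_poly_factors_GF_iff[OF z n t cyc_coset_subset[OF n(1)] this]
  show ?thesis
    unfolding coset_poly_eq_root_poly[where \<zeta> = \<zeta>, OF z n]
    using gcd_cyc_coset[OF n] mod_in_cyc_coset[OF n, of \<gamma>] by auto
qed

lemma monom_minus_one_factors_GF_iff:
  fixes z :: "'f alg_closure"
  assumes z: "primitive_root_of_unity n z" and n: "n > 0" "coprime n q" and t: "t > 0"
  shows "factors_into_irreducible_binomials (GF (q ^ t) :: 'f alg_closure set) (Polynomial.monom 1 n - 1) \<longleftrightarrow>
    omega q n dvd t"
  unfolding monom_minus_one_eq_root_poly[OF z n(1)]
    root_poly_factors_GF_iff[OF z n t order_refl cyc_coset_subset[OF n(1)]]
  using all_omega_dvd_iff[OF n, of t] by (simp add: Ball_def)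

text \<open>Abstract \<open>p\<close> and \<open>w\<close> allow one statement to serve both the
  coset polynomial and \<open>X ^ n - 1\<close>.\<close>

lemma extensions_filter_eq:
  assumes "T > 0"
    and "\<And>t. t > 0 \<Longrightarrow> factors_into_irreducible_binomials (GF (q ^ t) :: 'f alg_closure set) p \<longleftrightarrow> w dvd t"
  shows "{K \<in> extensions_within (GF (q ^ T) :: 'f alg_closure set). factors_into_irreducible_binomials K p} =
    (\<lambda>t. GF (q ^ t)) ` {t. t dvd T \<and> w dvd t}"
proof -
  have "t > 0" if "t dvd T" for t using that assms(1) by (auto intro: Nat.gr0I)
  then show ?thesis unfolding extensions_within_GF[OF assms(1)] using assms(2) by auto
qed

end

section \<open>The correspondence\<close>

text \<open>Decompositions and fields are both parametrised injectively by the same set of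
  \<open>t\<close>, so the correspondence is one parametrisation composed with the inverse of the
  other.\<close>

lemma ex_bij_betw_image:
  assumes "inj_on f T" "inj_on g T"
  shows "\<exists>\<chi>. (\<forall>t\<in>T. \<chi> (f t) = g t) \<and> bij_betw \<chi> (f ` T) (g ` T)"
proof -
  have "bij_betw (g \<circ> inv_into T f) (f ` T) (g ` T)"
    using assms by (intro bij_betw_trans[OF bij_betw_inv_into]) (auto simp: bij_betw_def)
  moreover have "\<forall>t\<in>T. (g \<circ> inv_into T f) (f t) = g t" using assms(1) by simp
  ultimately show ?thesis by blast
qed

theorem theorem5p2:
  fixes \<zeta> :: "nat \<Rightarrow> 'f :: finite_field alg_closure"
    and q n \<gamma> \<tau> \<omega>\<gamma> \<omega> :: nat
  assumes "q = card (UNIV :: 'f set)"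
    and "n > 0" and "coprime n q" and "\<gamma> < n"
    and "compatible_roots_of_unity q \<zeta>"
    and "\<tau> = card (cyc_coset n q \<gamma>)"
    and "\<omega>\<gamma> = omega q (n div gcd \<gamma> n)"
    and "\<omega> = omega q n"
  shows
    "(\<exists>\<chi> :: nat set set \<Rightarrow> 'f alg_closure set.
        (\<forall>t. t dvd \<tau> \<and> \<omega>\<gamma> dvd t \<longrightarrow> \<chi> (cyc_decomp n q t \<gamma>) = GF (q ^ t)) \<and>
        MER n q \<gamma> = {cyc_decomp n q t \<gamma> |t. t dvd \<tau> \<and> \<omega>\<gamma> dvd t} \<and>
        bij_betw \<chi> (MER n q \<gamma>)
          {K \<in> extensions_within (GF (q ^ \<tau>)).
             factors_into_irreducible_binomials K (coset_poly \<zeta> n q \<gamma>)})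
   \<and> (\<forall>t1 t2. t1 dvd \<tau> \<and> \<omega>\<gamma> dvd t1 \<and> t2 dvd \<tau> \<and> \<omega>\<gamma> dvd t2 \<longrightarrow>
        (finer (cyc_decomp n q t2 \<gamma>) (cyc_decomp n q t1 \<gamma>) \<longleftrightarrow>
         (GF (q ^ t1) :: 'f alg_closure set) \<subseteq> GF (q ^ t2)))
   \<and> (\<exists>\<chi> :: (nat set \<Rightarrow> nat set set) \<Rightarrow> 'f alg_closure set.
        (\<forall>t D. t dvd ord n q \<and> \<omega> dvd t \<and> is_cyc_decomp_tuple n q t D \<longrightarrow> \<chi> D = GF (q ^ t)) \<and>
        MER_all n q = {D. \<exists>t. t dvd ord n q \<and> \<omega> dvd t \<and> is_cyc_decomp_tuple n q t D} \<and>
        bij_betw \<chi> (MER_all n q)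
          {K \<in> extensions_within (GF (q ^ ord n q)).
             factors_into_irreducible_binomials K (Polynomial.monom 1 n - 1)})
   \<and> (\<forall>t1 t2 D1 D2.
        t1 dvd ord n q \<and> \<omega> dvd t1 \<and> is_cyc_decomp_tuple n q t1 D1 \<and>
        t2 dvd ord n q \<and> \<omega> dvd t2 \<and> is_cyc_decomp_tuple n q t2 D2 \<longrightarrow>
        (tuple_finer n q D2 D1 \<longleftrightarrow> (GF (q ^ t1) :: 'f alg_closure set) \<subseteq> GF (q ^ t2)))"
proof -
  note q = assms(1) and n = assms(2,3)
  define GF' where "GF' t = (GF (q ^ t) :: 'f alg_closure set)" for t
  have q0: "q > 0" using q_ge_2[OF q] by simp
  have z: "primitive_root_of_unity n (\<zeta> n)"
    using assms(5) n by (simp add: compatible_roots_of_unity_def)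
  have \<tau>: "\<tau> = ord (n div gcd \<gamma> n) q" by (simp add: assms(6) card_cyc_coset[OF n])
  then have "\<tau> > 0" using coprime_div_gcd[OF n(2)] by simp
  have "ord n q > 0" using n(2) by simp
  have GF_iff: "GF' t1 \<subseteq> GF' t2 \<longleftrightarrow> t1 dvd t2" if "t1 dvd T" "t2 dvd T" "T > 0" for t1 t2 T
    unfolding GF'_def using that by (intro GF_subset_iff[OF q]) (auto intro: Nat.gr0I)
  \<comment> \<open>A map that translates divisibility into inclusion is injective, since mutual
    divisibility of natural numbers is equality. The same argument gives \<open>inj1\<close> and
    \<open>inj2\<close>.\<close>
  then have inj_GF: "inj_on GF' {t. t dvd T \<and> w dvd t}" if "T > 0" for T w
    using that by (intro inj_onI) (metis (mono_tags, lifting) dvd_antisym mem_Collect_eq order_refl)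

  let ?A = "{t. t dvd \<tau> \<and> \<omega>\<gamma> dvd t}" and ?B = "{t. t dvd ord n q \<and> \<omega> dvd t}"
  have finer: "finer (cyc_decomp n q t2 \<gamma>) (cyc_decomp n q t1 \<gamma>) \<longleftrightarrow> t1 dvd t2"
    if "t1 dvd \<tau>" "t2 dvd \<tau>" for t1 t2
    using that finer_cyc_decomp_iff[OF n] by (simp add: \<tau>)
  then have inj1: "inj_on (\<lambda>t. cyc_decomp n q t \<gamma>) ?A"
    by (intro inj_onI) (metis (mono_tags, lifting) dvd_antisym dvd_refl mem_Collect_eq)
  have MER: "MER n q \<gamma> = (\<lambda>t. cyc_decomp n q t \<gamma>) ` ?A"
    using MER_eq[OF n q0] by (simp add: \<tau> assms(7))
  have fields1: "{K \<in> extensions_within (GF (q ^ \<tau>)).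
      factors_into_irreducible_binomials K (coset_poly \<zeta> n q \<gamma>)} = GF' ` ?A"
    unfolding GF'_def using coset_poly_factors_GF_iff[where \<zeta> = \<zeta>, OF q z n] \<open>\<tau> > 0\<close>
    by (intro extensions_filter_eq[OF q]) (simp_all add: assms(7))
  obtain \<chi> where \<chi>: "\<forall>t\<in>?A. \<chi> (cyc_decomp n q t \<gamma>) = GF' t"
    "bij_betw \<chi> ((\<lambda>t. cyc_decomp n q t \<gamma>) ` ?A) (GF' ` ?A)"
    using ex_bij_betw_image[OF inj1 inj_GF[OF \<open>\<tau> > 0\<close>]] by blast

  \<comment> \<open>Each admissible \<open>t\<close> determines its tuple, so the quantified tuples
    in the claim can be replaced by \<open>decomp_tuple n q t\<close>.\<close>
  have tuple: "is_cyc_decomp_tuple n q t D \<longleftrightarrow> D = decomp_tuple n q t" if "t dvd ord n q" for t D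
    using dvd_pos_nat[OF \<open>ord n q > 0\<close> that] by (rule is_cyc_decomp_tuple_iff[OF n])
  have tuple_finer: "tuple_finer n q (decomp_tuple n q t2) (decomp_tuple n q t1) \<longleftrightarrow> t1 dvd t2"
    if "t1 dvd ord n q" "t2 dvd ord n q" for t1 t2
    using that by (rule tuple_finer_decomp_tuple_iff[OF n])
  then have inj2: "inj_on (decomp_tuple n q) ?B"
    by (intro inj_onI) (metis (mono_tags, lifting) dvd_antisym dvd_refl mem_Collect_eq)
  have MER_all: "MER_all n q = decomp_tuple n q ` ?B"
    using MER_all_eq[OF n q0] by (simp add: assms(8))
  have fields2: "{K \<in> extensions_within (GF (q ^ ord n q)).
      factors_into_irreducible_binomials K (Polynomial.monom (1 :: 'f alg_closure) n - 1)} = GF' ` ?B"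
    unfolding GF'_def using monom_minus_one_factors_GF_iff[OF q z n] \<open>ord n q > 0\<close>
    by (intro extensions_filter_eq[OF q]) (simp_all add: assms(8))
  obtain \<chi>' where \<chi>': "\<forall>t\<in>?B. \<chi>' (decomp_tuple n q t) = GF' t"
    "bij_betw \<chi>' (decomp_tuple n q ` ?B) (GF' ` ?B)"
    using ex_bij_betw_image[OF inj2 inj_GF[OF \<open>ord n q > 0\<close>]] by blast

  show ?thesis
    unfolding fields1 fields2
  proof (intro conjI)
    show "\<exists>\<chi> :: nat set set \<Rightarrow> 'f alg_closure set.
        (\<forall>t. t dvd \<tau> \<and> \<omega>\<gamma> dvd t \<longrightarrow> \<chi> (cyc_decomp n q t \<gamma>) = GF (q ^ t)) \<and>
        MER n q \<gamma> = {cyc_decomp n q t \<gamma> |t. t dvd \<tau> \<and> \<omega>\<gamma> dvd t} \<and>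
        bij_betw \<chi> (MER n q \<gamma>) (GF' ` ?A)"
      using \<chi> MER by (intro exI[of _ \<chi>]) (auto simp: GF'_def)
    show "\<forall>t1 t2. t1 dvd \<tau> \<and> \<omega>\<gamma> dvd t1 \<and> t2 dvd \<tau> \<and> \<omega>\<gamma> dvd t2 \<longrightarrow>
        (finer (cyc_decomp n q t2 \<gamma>) (cyc_decomp n q t1 \<gamma>) \<longleftrightarrow>
         (GF (q ^ t1) :: 'f alg_closure set) \<subseteq> GF (q ^ t2))"
      using finer GF_iff[OF _ _ \<open>\<tau> > 0\<close>] by (simp add: GF'_def)
    show "\<exists>\<chi> :: (nat set \<Rightarrow> nat set set) \<Rightarrow> 'f alg_closure set.
        (\<forall>t D. t dvd ord n q \<and> \<omega> dvd t \<and> is_cyc_decomp_tuple n q t D \<longrightarrow> \<chi> D = GF (q ^ t)) \<and>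
        MER_all n q = {D. \<exists>t. t dvd ord n q \<and> \<omega> dvd t \<and> is_cyc_decomp_tuple n q t D} \<and>
        bij_betw \<chi> (MER_all n q) (GF' ` ?B)"
      using \<chi>' MER_all tuple by (intro exI[of _ \<chi>']) (auto simp: GF'_def)
    show "\<forall>t1 t2 D1 D2.
        t1 dvd ord n q \<and> \<omega> dvd t1 \<and> is_cyc_decomp_tuple n q t1 D1 \<and>
        t2 dvd ord n q \<and> \<omega> dvd t2 \<and> is_cyc_decomp_tuple n q t2 D2 \<longrightarrow>
        (tuple_finer n q D2 D1 \<longleftrightarrow> (GF (q ^ t1) :: 'f alg_closure set) \<subseteq> GF (q ^ t2))"
      using GF_iff[OF _ _ \<open>ord n q > 0\<close>] unfolding GF'_def
      by (intro allI impI, elim conjE) (simp add: tuple tuple_finer)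
  qed
qed

end
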